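(* Let $\sigma>0$, $p\ge 0$, $0\le\nu\le p$, $\eta,\tau\ge 1$, and let $\beta\in\mathcal W_p$. Let $(X,W)\in\mathcal F^{8}_{\eta,\tau}$, $U\in\mathcal E^{4}_{\eta}$, and let $(Y_i,X_i,W_i)_{1\le i\le n}$ be an i.i.d. sample of $(Y,X,W)$, where $Y=\int_0^1\beta(t)X(t)\,dt+\sigma U$ and $\mathbb E[UW(t)]=0$ for $t\in[0,1]$. Let $\widehat\beta_\nu$ be the estimator defined in the context with threshold $\alpha=\alpha(n)>0$ satisfying $\alpha=o(1)$ and $(\alpha^2 n)^{-1}=o(1)$ as $n\to\infty$. Then $$\mathbb E\|\widehat\beta_\nu-\beta\|_\nu^2=o(1)\qquad\text{as } n\to\infty .$$
   Context: Basic notation. $L^2[0,1]$ is the Hilbert space of square integrable complex-valued functions with $\langle f,g\rangle=\int_0^1 f(t)\overline{g(t)}dt$, $\|f\|=\langle f,f\rangle^{1/2}$; $\phi_k(t)=\exp(2\pi i k t)$, $k\in\mathbb Z$. Weights: $\gamma_k=1+|2\pi k|^2$. For $\nu\in\mathbb R$, $\|f\|_\nu^2=\sum_{k\in\mathbb Z}\gamma_k^\nu|\langle f,\phi_k\rangle|^2$ and $\mathcal W_\nu=\{f\in L^2[0,1]:\|f\|_\nu<\infty\}$. Model. $X,W$ are real-valued centered random functions on $[0,1]$ with $\mathbb E\|X\|^2<\infty$, $\mathbb E\|W\|^2<\infty$; $Y$ is real-valued, and the slope function $\beta$ is real-valued. Second order stationarity. $\mathcal F$ is the set of all centered second order stationary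 pairs $(X,W)$: covariances depend only on differences of arguments, in particular $\mathrm{Cov}(X(t),W(s))=c_{WX}(s-t)$. It is a standing property that the $\phi_k$ diagonalize the cross-covariance operator $[T_{WX}f](s)=\int_0^1 f(t)\,\mathrm{Cov}(X(t),W(s))dt$, i.e. $T_{WX}\phi_k=c_k\phi_k$; equivalently, with $c_k=\mathbb E[\langle\phi_k,X\rangle\langle W,\phi_k\rangle]$, one has $\mathbb E[\langle\phi_k,X\rangle\langle W,\phi_j\rangle]=0$ for $j\neq k$. It is also a standing assumption that $T_{WX}$ is injective, i.e. $c_k\ne0$ for all $k$. Put $x_k=\mathrm{Var}\langle X,\phi_k\rangle$, $w_k=\mathrm{Var}\langle W,\phi_k\rangle$ (variance of a complex variable meaning $\mathbb E|\cdot|^2$ after centering), $\lambda_k=|c_k|^2/w_k$. Moment classes. For $m\in\mathbb N$, $\eta,\tau\ge1$: $\mathcal F^m_{\eta,\tau}$ is the set of $(X,W)\in\mathcal F$ with $\sup_k\mathbb E|\langle X,\phi_k\rangle/\sqrt{x_k}|^m\le\eta$, $\sup_k\mathbb E|\langle W,\phi_k\rangle/\sqrt{w_k}|^m\le\eta$ and $\max(1,\sup_k\lambda_k/w_k)\le\tau$. $\mathcal E^m_\eta$ is the set of centered real random variables $U$ with variance one and $\mathbb E|U|^m\le\eta$. Estimator. Given the sample and a threshold $\alpha>0$, for $k\in\mathbb Z$ let $\widehat c_k=\frac1n\sum_{i=1}^n\langle\phi_k,X_i\rangle\langle W_i,\phi_k\rangle$, $\widehat w_k=\frac1n\sum_{i=1}^n|\langle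 W_i,\phi_k\rangle|^2$, $\widehat W_i=\sum_{k}\frac{\overline{\widehat c_k}}{\widehat w_k}\mathbf 1\{\widehat w_k\ge\alpha\}\langle W_i,\phi_k\rangle\phi_k$, $\widehat\lambda_k=\frac1n\sum_{i=1}^n|\langle\widehat W_i,\phi_k\rangle|^2$, $\widehat g_k=\frac1n\sum_{i=1}^nY_i\langle\widehat W_i,\phi_k\rangle$, and $$\widehat\beta_\nu=\sum_{k\in\mathbb Z}\frac{\widehat g_k}{\widehat\lambda_k}\mathbf 1\{\widehat\lambda_k/\gamma_k^\nu\ge\alpha\}\,\phi_k .$$ *)

theory Defs
  imports "HOL-Probability.Probability"
begin

text \<open>Elements of the Hilbert space are represented by functions (not by equivalence classes);
  equality in the Hilbert space is equality almost everywhere.\<close>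

abbreviation I01 :: "real measure" where
  "I01 \<equiv> lebesgue_on {0..1}"

definition L2 :: "(real \<Rightarrow> complex) set" where
  "L2 = {f. f \<in> borel_measurable I01 \<and> integrable I01 (\<lambda>t. (cmod (f t))\<^sup>2)}"

definition ip :: "(real \<Rightarrow> complex) \<Rightarrow> (real \<Rightarrow> complex) \<Rightarrow> complex" where
  "ip f g = (LINT t|I01. f t * cnj (g t))"

definition L2norm :: "(real \<Rightarrow> complex) \<Rightarrow> real" where
  "L2norm f = sqrt (Re (ip f f))"

abbreviation cplx :: "(real \<Rightarrow> real) \<Rightarrow> real \<Rightarrow> complex" where
  "cplx f \<equiv> (\<lambda>t. complex_of_real (f t))"

definition \<phi> :: "int \<Rightarrow> real \<Rightarrow> complex" where
  "\<phi> k t = exp (2 * of_real pi * \<i> * of_int k * of_real t)"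

definition \<gamma> :: "int \<Rightarrow> real" where
  "\<gamma> k = 1 + \<bar>2 * pi * of_int k\<bar>\<^sup>2"

text \<open>The square of the weighted norm, with values in $[0,\infty]$; the integral against the
  counting measure is the sum over all integers.\<close>

definition wnorm2 :: "real \<Rightarrow> (real \<Rightarrow> complex) \<Rightarrow> ennreal" where
  "wnorm2 \<nu> f = (\<integral>\<^sup>+ k. ennreal (\<gamma> k powr \<nu> * (cmod (ip f (\<phi> k)))\<^sup>2) \<partial>count_space UNIV)"

definition sobolev :: "real \<Rightarrow> (real \<Rightarrow> complex) set" where
  "sobolev \<nu> = {f \<in> L2. wnorm2 \<nu> f < \<infinity>}"

definition L2real :: "(real \<Rightarrow> real) set" where
  "L2real = {f. cplx f \<in> L2}"

text \<open>The Borel sigma-algebra: the generating sets are the open sets of the seminorm, hence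
  closed under almost everywhere equality.\<close>

definition L2borel :: "(real \<Rightarrow> real) measure" where
  "L2borel = sigma L2real
     {A. A \<subseteq> L2real \<and> (\<forall>f\<in>A. \<exists>e>0. \<forall>g\<in>L2real. L2norm (\<lambda>t. cplx g t - cplx f t) < e \<longrightarrow> g \<in> A)}"

text \<open>The value of a random function at a point has to make sense (covariances are taken
  pointwise), so a random function is a jointly measurable process that is moreover a random
  element of the Hilbert space.\<close>

definition random_function :: "'a measure \<Rightarrow> ('a \<Rightarrow> real \<Rightarrow> real) \<Rightarrow> bool" where
  "random_function M X \<longleftrightarrow>
     case_prod X \<in> borel_measurable (M \<Otimes>\<^sub>M I01) \<and> X \<in> measurable M L2borel"

definition centered :: "'a measure \<Rightarrow> ('a \<Rightarrow> real \<Rightarrow> real) \<Rightarrow> bool" where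
  "centered M X \<longleftrightarrow>
     (\<forall>t\<in>{0..1}. integrable M (\<lambda>\<omega>. X \<omega> t) \<and> prob_space.expectation M (\<lambda>\<omega>. X \<omega> t) = 0)"

definition cov :: "'a measure \<Rightarrow> ('a \<Rightarrow> real) \<Rightarrow> ('a \<Rightarrow> real) \<Rightarrow> real" where
  "cov M A B = prob_space.expectation M
     (\<lambda>\<omega>. (A \<omega> - prob_space.expectation M A) * (B \<omega> - prob_space.expectation M B))"

definition cvar :: "'a measure \<Rightarrow> ('a \<Rightarrow> complex) \<Rightarrow> real" where
  "cvar M Z = prob_space.expectation M (\<lambda>\<omega>. (cmod (Z \<omega> - prob_space.expectation M Z))\<^sup>2)"

definition stationary_pair ::
    "'a measure \<Rightarrow> ('a \<Rightarrow> real \<Rightarrow> real) \<Rightarrow> ('a \<Rightarrow> real \<Rightarrow> real) \<Rightarrow> bool" where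
  "stationary_pair M X W \<longleftrightarrow>
     (\<forall>t\<in>{0..1}. integrable M (\<lambda>\<omega>. (X \<omega> t)\<^sup>2) \<and> integrable M (\<lambda>\<omega>. (W \<omega> t)\<^sup>2)) \<and>
     (\<exists>cX cW cWX :: real \<Rightarrow> real. \<forall>t\<in>{0..1}. \<forall>s\<in>{0..1}.
        cov M (\<lambda>\<omega>. X \<omega> t) (\<lambda>\<omega>. X \<omega> s) = cX (s - t) \<and>
        cov M (\<lambda>\<omega>. W \<omega> t) (\<lambda>\<omega>. W \<omega> s) = cW (s - t) \<and>
        cov M (\<lambda>\<omega>. X \<omega> t) (\<lambda>\<omega>. W \<omega> s) = cWX (s - t))"

definition cross_cov_op ::
    "'a measure \<Rightarrow> ('a \<Rightarrow> real \<Rightarrow> real) \<Rightarrow> ('a \<Rightarrow> real \<Rightarrow> real) \<Rightarrow> (real \<Rightarrow> complex) \<Rightarrow> real \<Rightarrow> complex" where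
  "cross_cov_op M X W f s =
     (LINT t|I01. f t * of_real (cov M (\<lambda>\<omega>. X \<omega> t) (\<lambda>\<omega>. W \<omega> s)))"

definition c_coef ::
    "'a measure \<Rightarrow> ('a \<Rightarrow> real \<Rightarrow> real) \<Rightarrow> ('a \<Rightarrow> real \<Rightarrow> real) \<Rightarrow> int \<Rightarrow> complex" where
  "c_coef M X W k = prob_space.expectation M (\<lambda>\<omega>. ip (\<phi> k) (cplx (X \<omega>)) * ip (cplx (W \<omega>)) (\<phi> k))"

definition coef_var :: "'a measure \<Rightarrow> ('a \<Rightarrow> real \<Rightarrow> real) \<Rightarrow> int \<Rightarrow> real" where
  "coef_var M X k = cvar M (\<lambda>\<omega>. ip (cplx (X \<omega>)) (\<phi> k))"

definition lam :: "'a measure \<Rightarrow> ('a \<Rightarrow> real \<Rightarrow> real) \<Rightarrow> ('a \<Rightarrow> real \<Rightarrow> real) \<Rightarrow> int \<Rightarrow> real" where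
  "lam M X W k = (cmod (c_coef M X W k))\<^sup>2 / coef_var M W k"

text \<open>Stationarity on the unit interval alone does not force the exponentials to be eigenfunctions
  of the cross-covariance operator (the covariance function need not be periodic); this, and the
  injectivity of the operator, are standing assumptions of the model and part of the class.\<close>

definition class_F :: "'a measure \<Rightarrow> (('a \<Rightarrow> real \<Rightarrow> real) \<times> ('a \<Rightarrow> real \<Rightarrow> real)) set" where
  "class_F M = {(X, W).
     random_function M X \<and> random_function M W \<and>
     centered M X \<and> centered M W \<and>
     integrable M (\<lambda>\<omega>. (L2norm (cplx (X \<omega>)))\<^sup>2) \<and>
     integrable M (\<lambda>\<omega>. (L2norm (cplx (W \<omega>)))\<^sup>2) \<and>
     stationary_pair M X W \<and>
     (\<forall>k. AE s in I01. cross_cov_op M X W (\<phi> k) s = c_coef M X W k * \<phi> k s) \<and>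
     (\<forall>f\<in>L2. (AE s in I01. cross_cov_op M X W f s = 0) \<longrightarrow> (AE t in I01. f t = 0))}"

definition class_F_mom ::
    "'a measure \<Rightarrow> nat \<Rightarrow> real \<Rightarrow> real \<Rightarrow> (('a \<Rightarrow> real \<Rightarrow> real) \<times> ('a \<Rightarrow> real \<Rightarrow> real)) set" where
  "class_F_mom M m \<eta> \<tau> = {(X, W) \<in> class_F M.
     (SUP k. \<integral>\<^sup>+ \<omega>. ennreal (cmod (ip (cplx (X \<omega>)) (\<phi> k) / of_real (sqrt (coef_var M X k))) ^ m) \<partial>M)
       \<le> ennreal \<eta> \<and>
     (SUP k. \<integral>\<^sup>+ \<omega>. ennreal (cmod (ip (cplx (W \<omega>)) (\<phi> k) / of_real (sqrt (coef_var M W k))) ^ m) \<partial>M)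
       \<le> ennreal \<eta> \<and>
     max 1 (SUP k. ennreal (lam M X W k / coef_var M W k)) \<le> ennreal \<tau>}"

definition class_E :: "'a measure \<Rightarrow> nat \<Rightarrow> real \<Rightarrow> ('a \<Rightarrow> real) set" where
  "class_E M m \<eta> = {U.
     integrable M U \<and> integrable M (\<lambda>\<omega>. (U \<omega>)\<^sup>2) \<and>
     prob_space.expectation M U = 0 \<and> prob_space.variance M U = 1 \<and>
     (\<integral>\<^sup>+ \<omega>. ennreal (\<bar>U \<omega>\<bar> ^ m) \<partial>M) \<le> ennreal \<eta>}"

text \<open>An i.i.d. sample \<open>Z 1, \<dots>, Z n\<close>, living on a probability space \<open>P\<close> of its own,
  of the random element \<open>Z\<^sub>0\<close> of the measurable space \<open>S\<close>.\<close>

definition iid_sample ::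
    "'b measure \<Rightarrow> 's measure \<Rightarrow> nat \<Rightarrow> (nat \<Rightarrow> 'b \<Rightarrow> 's) \<Rightarrow> 'a measure \<Rightarrow> ('a \<Rightarrow> 's) \<Rightarrow> bool" where
  "iid_sample P S n Z M Z\<^sub>0 \<longleftrightarrow>
     prob_space P \<and> prob_space.indep_vars P (\<lambda>_. S) Z {1..n} \<and>
     (\<forall>i\<in>{1..n}. distr P S (Z i) = distr M S Z\<^sub>0)"

text \<open>Everything is a function of the observed data: the sample size \<open>n\<close>, the responses \<open>y i\<close>,
  the regressors \<open>x i\<close> and the instruments \<open>w i\<close>, for \<open>1 \<le> i \<le> n\<close>. For square integrable
  data and a threshold \<open>\<alpha> > 0\<close> only finitely many terms of each of the two sums over all
  integers are nonzero, by Bessel's inequality; so there is no difference between pointwise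
  summation and summation in the Hilbert space.\<close>

definition c_hat :: "nat \<Rightarrow> (nat \<Rightarrow> real \<Rightarrow> real) \<Rightarrow> (nat \<Rightarrow> real \<Rightarrow> real) \<Rightarrow> int \<Rightarrow> complex" where
  "c_hat n x w k = 1 / of_nat n * (\<Sum>i=1..n. ip (\<phi> k) (cplx (x i)) * ip (cplx (w i)) (\<phi> k))"

definition w_hat :: "nat \<Rightarrow> (nat \<Rightarrow> real \<Rightarrow> real) \<Rightarrow> int \<Rightarrow> real" where
  "w_hat n w k = 1 / of_nat n * (\<Sum>i=1..n. (cmod (ip (cplx (w i)) (\<phi> k)))\<^sup>2)"

definition W_hat ::
    "real \<Rightarrow> nat \<Rightarrow> (nat \<Rightarrow> real \<Rightarrow> real) \<Rightarrow> (nat \<Rightarrow> real \<Rightarrow> real) \<Rightarrow> nat \<Rightarrow> real \<Rightarrow> complex" where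
  "W_hat \<alpha> n x w i t =
     (\<Sum>\<^sub>\<infinity>k. cnj (c_hat n x w k) / of_real (w_hat n w k) * of_bool (w_hat n w k \<ge> \<alpha>)
        * ip (cplx (w i)) (\<phi> k) * \<phi> k t)"

definition lam_hat ::
    "real \<Rightarrow> nat \<Rightarrow> (nat \<Rightarrow> real \<Rightarrow> real) \<Rightarrow> (nat \<Rightarrow> real \<Rightarrow> real) \<Rightarrow> int \<Rightarrow> real" where
  "lam_hat \<alpha> n x w k = 1 / of_nat n * (\<Sum>i=1..n. (cmod (ip (W_hat \<alpha> n x w i) (\<phi> k)))\<^sup>2)"

definition g_hat ::
    "real \<Rightarrow> nat \<Rightarrow> (nat \<Rightarrow> real) \<Rightarrow> (nat \<Rightarrow> real \<Rightarrow> real) \<Rightarrow> (nat \<Rightarrow> real \<Rightarrow> real) \<Rightarrow> int \<Rightarrow> complex" where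
  "g_hat \<alpha> n y x w k = 1 / of_nat n * (\<Sum>i=1..n. of_real (y i) * ip (W_hat \<alpha> n x w i) (\<phi> k))"

definition beta_hat ::
    "real \<Rightarrow> real \<Rightarrow> nat \<Rightarrow> (nat \<Rightarrow> real) \<Rightarrow> (nat \<Rightarrow> real \<Rightarrow> real) \<Rightarrow> (nat \<Rightarrow> real \<Rightarrow> real)
      \<Rightarrow> real \<Rightarrow> complex" where
  "beta_hat \<nu> \<alpha> n y x w t =
     (\<Sum>\<^sub>\<infinity>k. g_hat \<alpha> n y x w k / of_real (lam_hat \<alpha> n x w k)
        * of_bool (lam_hat \<alpha> n x w k / \<gamma> k powr \<nu> \<ge> \<alpha>) * \<phi> k t)"

end

theory Submission
  imports Defs
begin

text \<open>Write $\xi_k$ and $\omega_k$ for the Fourier coefficients of $X$ and $W$, and $b_k$ for those of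
  the slope. After cancellation the $k$-th coefficient of the estimator is $\widehat h_k/\widehat c_k$
  on the event that both thresholds are passed, where $\widehat h_k$ is the empirical mean of
  $Y\omega_k$, and zero off this event. On the event the thresholds give
  $|\widehat c_k|^2 \ge \alpha^2\gamma_k^\nu$, so the weighted squared error there is at most
  $|\widehat h_k - b_k \widehat c_k|^2/\alpha^2$. This numerator is the empirical mean of the variable
  $(Y - b_k\overline{\xi_k})\omega_k$, which is centred because the exponentials diagonalize the
  cross-covariance operator; its second moments are summable over $k$ since $\|X\|$, $\|W\|$ and
  $U$ have finite fourth moments. The variance part is thus $O(1/(n\alpha^2))$. Off the event the error is
  $\gamma_k^\nu|b_k|^2$, which is summable, and the probability of being off the event tends to zero
  for each $k$ by Chebyshev's inequality; dominated convergence over $k$ concludes.\<close>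

section \<open>The Hilbert space and its exponentials\<close>

text \<open>Three points lie behind the outline. The diagonalization hypothesis concerns one
  exponential at a time, and only almost every s, whereas centring the numerator needs
  E[<\<beta>,X> <W,\<phi>_k>] = b_k c_k for the whole slope. The passage is by linearity and
  continuity in the slope, hence by density of trigonometric polynomials, proved from
  Stone-Weierstrass on the circle. The same density yields Parseval, which turns sums over k into
  norms. Secondly, finite fourth moments of ||X|| and ||W|| are not hypotheses: the class only
  bounds normalized coefficients one by one. Expanding ||X||^4 as a double series and applying
  Cauchy-Schwarz to each mixed moment bounds its expectation by (1 + \<eta>) (E||X||^2)^2. Thirdly,
  the Chebyshev bound for leaving the event carries 1/w_k^2 and 1/|c_k|^2, and w_k tends to 0
  because it is summable. No rate is uniform in k, so the bias is treated for each k separately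
  under a summable majorant. Injectivity makes c_k, and then w_k, nonzero; \<nu> \<le> p makes the
  majorant summable.\<close>

lemma finite_measure_I01: "finite_measure I01"
  by (rule finite_measure_lebesgue_on) simp

lemma measure_I01 [simp]: "measure I01 {0..1} = 1"
  by (simp add: measure_restrict_space)

lemma sigma_finite_I01: "sigma_finite_measure I01"
  using finite_measure_I01 by (simp add: finite_measure_def)

lemma continuous_borel_I01:
  fixes f :: "real \<Rightarrow> 'b::{euclidean_space}"
  shows "continuous_on {0..1} f \<Longrightarrow> f \<in> borel_measurable I01"
  by (rule continuous_imp_measurable_on_sets_lebesgue) auto

lemma L2_measurable: "f \<in> L2 \<Longrightarrow> f \<in> borel_measurable I01"
  by (simp add: L2_def)

lemma L2_square_integrable: "f \<in> L2 \<Longrightarrow> integrable I01 (\<lambda>t. (cmod (f t))\<^sup>2)"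
  by (simp add: L2_def)

lemma L2_bounded:
  assumes [measurable]: "f \<in> borel_measurable I01" and "\<And>t. t \<in> {0..1} \<Longrightarrow> cmod (f t) \<le> B"
  shows "f \<in> L2"
proof -
  interpret finite_measure I01 by (rule finite_measure_I01)
  have "integrable I01 (\<lambda>t. (cmod (f t))\<^sup>2)"
    by (rule integrable_const_bound[where B="B\<^sup>2"]) (auto intro!: power_mono assms)
  then show ?thesis by (simp add: L2_def)
qed

lemma measurable_cnj [measurable]: "cnj \<in> borel_measurable borel"
  by (intro borel_measurable_continuous_onI continuous_intros)

section \<open>Elementary inequalities for squares and the Cauchy-Schwarz inequality\<close>

lemma norm_add_sq_le: "(cmod (a + b))\<^sup>2 \<le> 2 * (cmod a)\<^sup>2 + 2 * (cmod b)\<^sup>2"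
proof -
  have "(cmod (a + b))\<^sup>2 \<le> (cmod a + cmod b)\<^sup>2"
    by (intro power_mono norm_triangle_ineq) auto
  then show ?thesis using sum_squares_bound[of "cmod a" "cmod b"]
    by (simp add: power2_sum)
qed

lemma mult_le_sum_squares: "x * y \<le> x\<^sup>2 + (y::real)\<^sup>2"
proof -
  have "2 * (x * y) \<le> x\<^sup>2 + y\<^sup>2" using sum_squares_bound[of x y] by simp
  moreover have "0 \<le> x\<^sup>2 + y\<^sup>2" by simp
  ultimately show ?thesis by linarith
qed

lemma integrable_mult_of_squares:
  fixes f g :: "'x \<Rightarrow> 'b::{real_normed_algebra, banach, second_countable_topology}"
  assumes [measurable]: "f \<in> borel_measurable M" "g \<in> borel_measurable M"
    and "integrable M (\<lambda>t. (norm (f t))\<^sup>2)" "integrable M (\<lambda>t. (norm (g t))\<^sup>2)"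
  shows "integrable M (\<lambda>t. f t * g t)"
proof (rule Bochner_Integration.integrable_bound)
  show "integrable M (\<lambda>t. (norm (f t))\<^sup>2 + (norm (g t))\<^sup>2)"
    using assms by auto
  show "AE t in M. norm (f t * g t) \<le> norm ((norm (f t))\<^sup>2 + (norm (g t))\<^sup>2)"
    by (auto intro!: AE_I2 order_trans[OF norm_mult_ineq] mult_le_sum_squares)
qed simp

lemma integral_mult_squared_le:
  fixes f g :: "'x \<Rightarrow> real"
  assumes [measurable]: "f \<in> borel_measurable M" "g \<in> borel_measurable M"
    and f: "integrable M (\<lambda>t. (f t)\<^sup>2)" and g: "integrable M (\<lambda>t. (g t)\<^sup>2)"
  shows "(LINT t|M. \<bar>f t\<bar> * \<bar>g t\<bar>)\<^sup>2 \<le> (LINT t|M. (f t)\<^sup>2) * (LINT t|M. (g t)\<^sup>2)"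
proof -
  have i: "integrable M (\<lambda>t. \<bar>f t\<bar> * \<bar>g t\<bar>)"
    by (rule integrable_mult_of_squares) (auto simp: f g)
  have "(\<integral>\<^sup>+t. ennreal \<bar>f t\<bar> * ennreal \<bar>g t\<bar> \<partial>M)\<^sup>2
      \<le> (\<integral>\<^sup>+t. (ennreal \<bar>f t\<bar>)\<^sup>2 \<partial>M) * (\<integral>\<^sup>+t. (ennreal \<bar>g t\<bar>)\<^sup>2 \<partial>M)"
    by (rule Cauchy_Schwarz_nn_integral) auto
  also have "(\<lambda>t. ennreal \<bar>f t\<bar> * ennreal \<bar>g t\<bar>) = (\<lambda>t. ennreal (\<bar>f t\<bar> * \<bar>g t\<bar>))"
    by (simp add: ennreal_mult)
  also have "(\<lambda>t. (ennreal \<bar>f t\<bar>)\<^sup>2) = (\<lambda>t. ennreal ((f t)\<^sup>2))"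
    by (simp add: ennreal_power)
  also have "(\<lambda>t. (ennreal \<bar>g t\<bar>)\<^sup>2) = (\<lambda>t. ennreal ((g t)\<^sup>2))"
    by (simp add: ennreal_power)
  also have "(\<integral>\<^sup>+t. ennreal (\<bar>f t\<bar> * \<bar>g t\<bar>) \<partial>M) = ennreal (LINT t|M. \<bar>f t\<bar> * \<bar>g t\<bar>)"
    by (rule nn_integral_eq_integral[OF i]) auto
  also have "(\<integral>\<^sup>+t. ennreal ((f t)\<^sup>2) \<partial>M) = ennreal (LINT t|M. (f t)\<^sup>2)"
    by (rule nn_integral_eq_integral[OF f]) auto
  also have "(\<integral>\<^sup>+t. ennreal ((g t)\<^sup>2) \<partial>M) = ennreal (LINT t|M. (g t)\<^sup>2)"
    by (rule nn_integral_eq_integral[OF g]) auto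
  finally show ?thesis
    by (simp add: ennreal_power flip: ennreal_mult)
qed

section \<open>Linear structure and inner product of \<open>L2\<close>\<close>

lemma L2_mult_integrable:
  assumes "f \<in> L2" "g \<in> L2"
  shows "integrable I01 (\<lambda>t. f t * cnj (g t))"
  using L2_measurable[OF assms(1)] L2_measurable[OF assms(2)]
    L2_square_integrable[OF assms(1)] L2_square_integrable[OF assms(2)]
  by (intro integrable_mult_of_squares) auto

lemma L2_cmult: "f \<in> L2 \<Longrightarrow> (\<lambda>t. c * f t) \<in> L2"
  by (auto simp: L2_def norm_mult power_mult_distrib)

lemma L2_add:
  assumes "f \<in> L2" "g \<in> L2"
  shows "(\<lambda>t. f t + g t) \<in> L2"
proof -
  have [measurable]: "f \<in> borel_measurable I01" "g \<in> borel_measurable I01"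
    using assms by (auto intro: L2_measurable)
  have "integrable I01 (\<lambda>t. (cmod (f t + g t))\<^sup>2)"
  proof (rule Bochner_Integration.integrable_bound)
    show "integrable I01 (\<lambda>t. 2 * (cmod (f t))\<^sup>2 + 2 * (cmod (g t))\<^sup>2)"
      using assms by (intro Bochner_Integration.integrable_add integrable_mult_right L2_square_integrable)
    have "(cmod (f t + g t))\<^sup>2 \<le> 2 * (cmod (f t))\<^sup>2 + 2 * (cmod (g t))\<^sup>2" for t
      by (rule norm_add_sq_le)
    then show "AE t in I01. norm ((cmod (f t + g t))\<^sup>2) \<le> norm (2 * (cmod (f t))\<^sup>2 + 2 * (cmod (g t))\<^sup>2)"
      by auto
  qed simp
  then show ?thesis by (simp add: L2_def)
qed

lemma L2_diff: "f \<in> L2 \<Longrightarrow> g \<in> L2 \<Longrightarrow> (\<lambda>t. f t - g t) \<in> L2"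
  using L2_add[of f "\<lambda>t. -1 * g t"] L2_cmult[of g "-1"] by simp

lemma L2_sum: "(\<And>k. k \<in> K \<Longrightarrow> f k \<in> L2) \<Longrightarrow> (\<lambda>t. \<Sum>k\<in>K. f k t) \<in> L2"
proof (induction K rule: infinite_finite_induct)
  case (insert x F)
  then show ?case using L2_add[of "f x" "\<lambda>t. \<Sum>k\<in>F. f k t"] by simp
qed (auto intro!: L2_bounded)

lemma ip_diff_left:
  "f \<in> L2 \<Longrightarrow> g \<in> L2 \<Longrightarrow> h \<in> L2 \<Longrightarrow> ip (\<lambda>t. f t - g t) h = ip f h - ip g h"
  unfolding ip_def by (simp add: left_diff_distrib L2_mult_integrable Bochner_Integration.integral_diff)

lemma ip_cmult_left: "ip (\<lambda>t. c * f t) h = c * ip f h"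
  unfolding ip_def by (simp add: mult.assoc)

lemma ip_sum_left:
  assumes "\<And>k. k \<in> K \<Longrightarrow> f k \<in> L2" "h \<in> L2"
  shows "ip (\<lambda>t. \<Sum>k\<in>K. f k t) h = (\<Sum>k\<in>K. ip (f k) h)"
  unfolding ip_def sum_distrib_right
  by (rule Bochner_Integration.integral_sum) (auto intro: L2_mult_integrable assms)

lemma ip_cnj: "cnj (ip f g) = ip g f"
  unfolding ip_def Bochner_Integration.integral_cnj[symmetric] by (simp add: mult.commute)

lemma ip_self: "ip f f = of_real (LINT t|I01. (cmod (f t))\<^sup>2)"
  unfolding ip_def by (simp add: complex_norm_square[symmetric] flip: integral_complex_of_real)

lemma L2norm_sq: "(L2norm f)\<^sup>2 = (LINT t|I01. (cmod (f t))\<^sup>2)"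
  by (simp add: L2norm_def ip_self)

lemma L2norm_nonneg: "0 \<le> L2norm f"
  by (simp add: L2norm_def ip_self)

lemma ip_self_L2norm: "ip f f = of_real ((L2norm f)\<^sup>2)"
  by (simp add: L2norm_sq ip_self)

lemma ip_Cauchy_Schwarz:
  assumes "f \<in> L2" "g \<in> L2"
  shows "cmod (ip f g) \<le> L2norm f * L2norm g"
proof -
  have [measurable]: "f \<in> borel_measurable I01" "g \<in> borel_measurable I01"
    using assms by (auto intro: L2_measurable)
  have "cmod (ip f g) \<le> (LINT t|I01. \<bar>cmod (f t)\<bar> * \<bar>cmod (g t)\<bar>)"
    unfolding ip_def
    by (rule order_trans[OF integral_norm_bound]) (simp add: norm_mult)
  moreover have "(LINT t|I01. \<bar>cmod (f t)\<bar> * \<bar>cmod (g t)\<bar>)\<^sup>2 \<le> (L2norm f * L2norm g)\<^sup>2"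
    unfolding power_mult_distrib L2norm_sq
    by (rule integral_mult_squared_le) (auto intro: L2_square_integrable assms)
  then have "(LINT t|I01. \<bar>cmod (f t)\<bar> * \<bar>cmod (g t)\<bar>) \<le> L2norm f * L2norm g"
    by (rule power2_le_imp_le) (simp add: L2norm_nonneg)
  ultimately show ?thesis by linarith
qed

lemma L2norm_triangle_sq:
  assumes "f \<in> L2" "g \<in> L2"
  shows "(L2norm (\<lambda>t. f t + g t))\<^sup>2 \<le> 2 * (L2norm f)\<^sup>2 + 2 * (L2norm g)\<^sup>2"
proof -
  have "(cmod (f t + g t))\<^sup>2 \<le> 2 * (cmod (f t))\<^sup>2 + 2 * (cmod (g t))\<^sup>2" for t
    by (rule norm_add_sq_le)
  then have "(LINT t|I01. (cmod (f t + g t))\<^sup>2) \<le> (LINT t|I01. 2 * (cmod (f t))\<^sup>2 + 2 * (cmod (g t))\<^sup>2)"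
    using assms L2_add[OF assms]
    by (intro integral_mono Bochner_Integration.integrable_add integrable_mult_right L2_square_integrable)
  also have "\<dots> = 2 * (LINT t|I01. (cmod (f t))\<^sup>2) + 2 * (LINT t|I01. (cmod (g t))\<^sup>2)"
    using assms by (subst Bochner_Integration.integral_add) (auto intro: L2_square_integrable)
  finally show ?thesis unfolding L2norm_sq .
qed

section \<open>The exponentials as an orthonormal family\<close>

lemma phi_add: "\<phi> (j + k) t = \<phi> j t * \<phi> k t"
  by (simp add: \<phi>_def distrib_left distrib_right exp_add)

lemma phi_0: "\<phi> 0 t = 1"
  by (simp add: \<phi>_def)

lemma phi_cis: "\<phi> k t = cis (2 * pi * of_int k * t)"
  by (simp add: \<phi>_def cis_conv_exp mult_ac)

lemma norm_phi [simp]: "cmod (\<phi> k t) = 1"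
  by (simp add: phi_cis)

lemma cnj_phi: "cnj (\<phi> k t) = \<phi> (- k) t"
  by (simp add: phi_cis cis_cnj)

lemma continuous_on_phi [continuous_intros]: "continuous_on S (\<phi> k)"
  unfolding \<phi>_def by (intro continuous_intros)

lemma phi_measurable [measurable]: "\<phi> k \<in> borel_measurable I01"
  by (intro continuous_borel_I01 continuous_on_phi)

lemma L2_phi: "\<phi> k \<in> L2"
  by (rule L2_bounded[where B=1]) auto

lemma integral_phi: "(LINT t|I01. \<phi> k t) = of_bool (k = 0)"
proof (cases "k = 0")
  case True then show ?thesis by (simp add: phi_0)
next
  case False
  define c where "c = 2 * of_real pi * \<i> * of_int k"
  have c: "c \<noteq> 0" using False by (simp add: c_def)
  have "((\<lambda>t. exp (c * of_real t)) has_integral (exp (c * of_real 1) / c - exp (c * of_real 0) / c)) {0..1}"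
  proof (rule fundamental_theorem_of_calculus)
    fix t :: real
    have "((\<lambda>z. exp (c * z) / c) has_field_derivative exp (c * of_real t)) (at (of_real t))"
      using c by (auto intro!: derivative_eq_intros)
    from has_vector_derivative_real_field[OF this]
    show "((\<lambda>x. exp (c * complex_of_real x) / c) has_vector_derivative exp (c * of_real t)) (at t within {0..1})" .
  qed simp
  moreover have "exp c = 1"
    using exp_integer_2pi[of "of_int k"] by (simp add: c_def mult_ac)
  ultimately have "((\<lambda>t. exp (c * of_real t)) has_integral 0) {0..1}" by simp
  then have "integral {0..1} (\<phi> k) = 0"
    by (intro integral_unique) (simp add: \<phi>_def[abs_def] c_def)
  moreover have "integrable I01 (\<phi> k)"
    using L2_mult_integrable[OF L2_phi[of k] L2_phi[of 0]] by (simp add: phi_0)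
  ultimately show ?thesis using False
    by (simp add: lebesgue_integral_eq_integral)
qed

lemma ip_phi_phi: "ip (\<phi> j) (\<phi> k) = of_bool (j = k)"
proof -
  have "ip (\<phi> j) (\<phi> k) = (LINT t|I01. \<phi> (j - k) t)"
    unfolding ip_def by (simp add: cnj_phi flip: phi_add)
  then show ?thesis by (simp add: integral_phi)
qed

lemma L2norm_phi: "L2norm (\<phi> k) = 1"
  by (simp add: L2norm_def ip_phi_phi)

section \<open>Density of trigonometric polynomials and Parseval's identity\<close>

definition trigpoly :: "(real \<Rightarrow> complex) \<Rightarrow> bool" where
  "trigpoly q \<longleftrightarrow> (\<exists>K a. finite K \<and> q = (\<lambda>t. \<Sum>k\<in>K. a k * \<phi> k t))"

lemma trigpolyI: "finite K \<Longrightarrow> trigpoly (\<lambda>t. \<Sum>k\<in>K. a k * \<phi> k t)"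
  unfolding trigpoly_def by blast

lemma trigpoly_add:
  assumes "trigpoly p" "trigpoly q"
  shows "trigpoly (\<lambda>t. p t + q t)"
proof -
  obtain K a L b where K: "finite K" "p = (\<lambda>t. \<Sum>k\<in>K. a k * \<phi> k t)"
    and L: "finite L" "q = (\<lambda>t. \<Sum>k\<in>L. b k * \<phi> k t)"
    using assms unfolding trigpoly_def by blast
  have "(\<Sum>k\<in>K. a k * \<phi> k t) + (\<Sum>k\<in>L. b k * \<phi> k t)
      = (\<Sum>k\<in>K \<union> L. ((if k \<in> K then a k else 0) + (if k \<in> L then b k else 0)) * \<phi> k t)" for t
  proof -
    have "(\<Sum>k\<in>K. a k * \<phi> k t) = (\<Sum>k\<in>K \<union> L. (if k \<in> K then a k else 0) * \<phi> k t)"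
      using K L by (intro sum.mono_neutral_cong_left) auto
    moreover have "(\<Sum>k\<in>L. b k * \<phi> k t) = (\<Sum>k\<in>K \<union> L. (if k \<in> L then b k else 0) * \<phi> k t)"
      using K L by (intro sum.mono_neutral_cong_left) auto
    ultimately show ?thesis by (simp add: distrib_right sum.distrib)
  qed
  then show ?thesis using K L by (simp add: trigpolyI)
qed

lemma trigpoly_monomial_mult:
  assumes "trigpoly q"
  shows "trigpoly (\<lambda>t. c * \<phi> j t * q t)"
proof -
  obtain K a where K: "finite K" "q = (\<lambda>t. \<Sum>k\<in>K. a k * \<phi> k t)"
    using assms unfolding trigpoly_def by blast
  have "c * \<phi> j t * (\<Sum>k\<in>K. a k * \<phi> k t) = (\<Sum>m\<in>(+) j ` K. c * a (m - j) * \<phi> m t)" for t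
    by (subst sum.reindex) (auto simp: sum_distrib_left phi_add mult_ac)
  then show ?thesis using K by (simp add: trigpolyI)
qed

lemma trigpoly_monomial: "trigpoly (\<lambda>t. c * \<phi> j t)"
  using trigpolyI[of "{j}" "\<lambda>_. c"] by simp

lemma trigpoly_sum:
  assumes "finite K" "\<And>k. k \<in> K \<Longrightarrow> trigpoly (f k)"
  shows "trigpoly (\<lambda>t. \<Sum>k\<in>K. f k t)"
  using assms
proof (induction K)
  case empty
  then show ?case using trigpoly_monomial[of 0] by simp
next
  case (insert x F)
  then show ?case using trigpoly_add[of "f x" "\<lambda>t. \<Sum>k\<in>F. f k t"] by simp
qed

lemma trigpoly_mult:
  assumes "trigpoly p" "trigpoly q"
  shows "trigpoly (\<lambda>t. p t * q t)"
proof -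
  obtain K a where K: "finite K" "p = (\<lambda>t. \<Sum>k\<in>K. a k * \<phi> k t)"
    using assms unfolding trigpoly_def by blast
  then show ?thesis
    unfolding K sum_distrib_right by (intro trigpoly_sum trigpoly_monomial_mult assms)
qed

text \<open>On the unit circle the conjugate of \<open>\<phi> 1 t\<close> is
  \<open>\<phi> (- 1) t\<close>, so a real linear functional of a point of the circle is a
  combination of two exponentials, and sums and products stay in the class. This turns the
  polynomials in two real coordinates supplied by Stone-Weierstrass into trigonometric
  polynomials.\<close>

lemma trigpoly_real_polynomial_function:
  fixes g :: "complex \<Rightarrow> real"
  assumes "real_polynomial_function g"
  shows "trigpoly (\<lambda>t. of_real (g (\<phi> 1 t)))"
  using assms
proof (induction g rule: real_polynomial_function.induct)
  case (linear f)
  interpret bounded_linear f by fact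
  \<comment> \<open>Substitute Re z = (z + cnj z)/2 and Im z = (z - cnj z)/(2i) into the expansion
    of \<open>f\<close> in the real basis 1, i.\<close>
  have f: "of_real (f (\<phi> 1 t)) = ((f 1 - \<i> * f \<i>) / 2) * \<phi> 1 t + ((f 1 + \<i> * f \<i>) / 2) * \<phi> (- 1) t" for t
  proof -
    have "\<phi> 1 t = Re (\<phi> 1 t) *\<^sub>R 1 + Im (\<phi> 1 t) *\<^sub>R \<i>"
      by (simp add: complex_eq_iff)
    then have "f (\<phi> 1 t) = Re (\<phi> 1 t) * f 1 + Im (\<phi> 1 t) * f \<i>"
      by (metis add scaleR real_scaleR_def)
    then show ?thesis
      by (simp add: complex_eq_iff cnj_phi[symmetric] field_simps)
  qed
  show ?case unfolding f by (intro trigpoly_add trigpoly_monomial)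
next
  case (const c)
  show ?case using trigpoly_monomial[of "of_real c" 0] by (simp add: phi_0)
next
  case (add f g)
  then show ?case using trigpoly_add by fastforce
next
  case (mult f g)
  then show ?case using trigpoly_mult by fastforce
qed

text \<open>The approximation takes place on the circle and not on the interval: a continuous
  function on the interval with different end values is no uniform limit of 1-periodic
  functions.\<close>

lemma trigpoly_approx_continuous:
  fixes G :: "complex \<Rightarrow> real"
  assumes "continuous_on (sphere 0 1) G" "e > 0"
  obtains p where "trigpoly p" "\<And>t. cmod (of_real (G (\<phi> 1 t)) - p t) < e"
proof -
  obtain g where g: "real_polynomial_function g" "\<And>x. x \<in> sphere 0 1 \<Longrightarrow> \<bar>G x - g x\<bar> < e"
    using Stone_Weierstrass_real_polynomial_function[OF compact_sphere assms] by blast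
  show ?thesis
  proof
    show "trigpoly (\<lambda>t. of_real (g (\<phi> 1 t)))"
      by (rule trigpoly_real_polynomial_function[OF g(1)])
    show "cmod (of_real (G (\<phi> 1 t)) - of_real (g (\<phi> 1 t))) < e" for t
      using g(2)[of "\<phi> 1 t"] by (simp flip: of_real_diff)
  qed
qed

text \<open>The factor vanishing at 1 glues the two ends of the unit interval continuously.\<close>

lemma bounded_circle_approx:
  fixes f :: "real \<Rightarrow> real"
  assumes f: "f \<in> borel_measurable I01" and B: "\<And>t. t \<in> {0..1} \<Longrightarrow> \<bar>f t\<bar> \<le> B"
  obtains G :: "nat \<Rightarrow> complex \<Rightarrow> real"
  where "\<And>n. continuous_on (sphere 0 1) (G n)" "\<And>n z. \<bar>G n z\<bar> \<le> B"
    "AE t in I01. (\<lambda>n. G n (\<phi> 1 t)) \<longlonglongrightarrow> f t"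
proof -
  have B0: "0 \<le> B" using B[of 0] by simp
  have "(\<lambda>t. if t \<in> {0..1} then f t else 0) \<in> borel_measurable lebesgue"
    by (rule borel_measurable_if_I[OF f]) simp
  \<comment> \<open>By definition, \<open>measurable_on\<close> provides continuous functions on the
    whole line converging pointwise off a negligible set; these are the raw approximants.\<close>
  then have "(\<lambda>t. if t \<in> {0..1} then f t else 0) measurable_on {0..1}"
    by (rule lebesgue_measurable_imp_measurable_on_real) simp
  then obtain N g where N: "negligible N" and g: "\<And>n::nat. continuous_on UNIV (g n)"
    and lim: "\<And>t. t \<notin> N \<Longrightarrow> t \<in> {0..1} \<Longrightarrow> (\<lambda>n. g n t) \<longlonglongrightarrow> f t"
    unfolding measurable_on_def by force
  \<comment> \<open>\<open>Arg2pi z / (2 * pi)\<close> recovers t from \<open>\<phi> 1 t\<close> for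
    t strictly between 0 and 1. The clamp to [-B, B] gives the uniform bound without disturbing the
    limit, and it makes the product tend to 0 at z = 1, where \<open>Arg2pi\<close> jumps.\<close>
  define G where "G n z = min 1 (real n * cmod (z - 1)) * max (-B) (min B (g n (Arg2pi z / (2 * pi))))"
    for n z
  have cl: "\<bar>max (-B) (min B x)\<bar> \<le> B" for x using B0 by auto
  show ?thesis
  proof
    show "\<bar>G n z\<bar> \<le> B" for n z
    proof -
      have "\<bar>G n z\<bar> \<le> 1 * B"
        unfolding G_def abs_mult by (intro mult_mono cl) auto
      then show ?thesis by simp
    qed
    show "continuous_on (sphere 0 1) (G n)" for n
    proof (intro continuous_at_imp_continuous_on ballI)
      fix z :: complex assume z: "z \<in> sphere 0 1"
      show "isCont (G n) z"
      proof (cases "z = 1")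
        case True
        have "(G n \<longlongrightarrow> 0) (at 1)"
        proof (rule Lim_null_comparison)
          show "\<forall>\<^sub>F z in at 1. norm (G n z) \<le> real n * cmod (z - 1) * B"
            unfolding G_def real_norm_def abs_mult
            by (intro always_eventually allI mult_mono cl) auto
          have "((\<lambda>z. real n * cmod (z - 1) * B) \<longlongrightarrow> real n * cmod (1 - 1) * B) (at 1)"
            by (intro tendsto_intros)
          then show "((\<lambda>z. real n * cmod (z - 1) * B) \<longlongrightarrow> 0) (at 1)" by simp
        qed
        then show ?thesis by (simp add: True isCont_def G_def)
      next
        case False
        have "z \<notin> \<real>\<^sub>\<ge>\<^sub>0"
        proof
          assume "z \<in> \<real>\<^sub>\<ge>\<^sub>0"
          then obtain r where "r \<ge> 0" "z = of_real r" by (auto simp: nonneg_Reals_def)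
          then show False using z False by simp
        qed
        then have A: "isCont Arg2pi z" by (rule continuous_at_Arg2pi)
        have "isCont (g n) x" for x using g[of n] by (simp add: continuous_on_eq_continuous_at)
        then have "isCont (\<lambda>z. g n (Arg2pi z / (2 * pi))) z"
          by (rule isCont_o2[rotated]) (intro continuous_intros A, simp)
        then show ?thesis
          unfolding G_def by (intro continuous_intros)
      qed
    qed
    \<comment> \<open>At both endpoints \<open>\<phi> 1 t\<close> is 1, where every
      \<open>G n\<close> is zero; they are moved into the exceptional set.\<close>
    have "negligible (N \<union> {0, 1})" using N by (intro negligible_Un) auto
    then have "N \<union> {0,1} \<in> null_sets lebesgue" by (simp add: negligible_iff_null_sets)
    then have "AE t in lebesgue. t \<notin> N \<union> {0, 1}" by (rule AE_not_in)
    then have "AE t in I01. t \<notin> N \<union> {0,1}"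
      by (subst AE_restrict_space_iff) auto
    then show "AE t in I01. (\<lambda>n. G n (\<phi> 1 t)) \<longlonglongrightarrow> f t"
    proof (rule AE_mp, intro AE_I2 impI)
      fix t assume "t \<in> space I01" and tN: "t \<notin> N \<union> {0, 1}"
      then have t: "0 < t" "t < 1" "t \<in> {0..1}" by auto
      have "\<phi> 1 t = exp (\<i> * of_real (2 * pi * t))" by (simp add: \<phi>_def mult_ac)
      then have "Arg2pi (\<phi> 1 t) = 2 * pi * t"
        using t by (simp add: Arg2pi_exp del: of_real_mult)
      then have A: "Arg2pi (\<phi> 1 t) / (2 * pi) = t" by simp
      have ne: "\<phi> 1 t \<noteq> 1"
      proof
        assume "\<phi> 1 t = 1"
        then have "Arg2pi (\<phi> 1 t) = 0" using Arg2pi_of_real[of 1] by simp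
        with A t show False by simp
      qed
      have "(\<lambda>n. max (-B) (min B (g n t))) \<longlonglongrightarrow> max (-B) (min B (f t))"
        by (intro tendsto_intros lim) (use tN t in auto)
      also have "max (-B) (min B (f t)) = f t" using B[OF t(3)] by auto
      finally have 1: "(\<lambda>n. max (-B) (min B (g n t))) \<longlonglongrightarrow> f t" .
      have "filterlim (\<lambda>n. real n * cmod (\<phi> 1 t - 1)) at_top sequentially"
        using ne by (intro filterlim_at_top_mult_tendsto_pos[OF tendsto_const _ filterlim_real_sequentially, of "cmod (\<phi> 1 t - 1)", unfolded mult.commute[of "cmod _"]])
           (auto simp: mult.commute)
      then have "\<forall>\<^sub>F n in sequentially. 1 \<le> real n * cmod (\<phi> 1 t - 1)"
        by (simp add: filterlim_at_top)
      then have "\<forall>\<^sub>F n in sequentially. min 1 (real n * cmod (\<phi> 1 t - 1)) = 1"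
        by eventually_elim auto
      then have "(\<lambda>n. min 1 (real n * cmod (\<phi> 1 t - 1))) \<longlonglongrightarrow> 1"
        by (rule tendsto_eventually)
      from tendsto_mult[OF this 1] show "(\<lambda>n. G n (\<phi> 1 t)) \<longlonglongrightarrow> f t"
        unfolding G_def A by simp
    qed
  qed
qed

lemma trigpoly_L2: "trigpoly p \<Longrightarrow> p \<in> L2"
  unfolding trigpoly_def by (elim exE conjE, hypsubst) (intro L2_sum L2_cmult L2_phi)

text \<open>Two approximations are chained: in mean square by a continuous function on the circle,
  through dominated convergence with the constant majorant (2B)^2, and then uniformly by a
  trigonometric polynomial.\<close>

lemma trigpoly_dense_bounded:
  fixes f :: "real \<Rightarrow> real"
  assumes [measurable]: "f \<in> borel_measurable I01" and B: "\<And>t. t \<in> {0..1} \<Longrightarrow> \<bar>f t\<bar> \<le> B" and "e > 0"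
  obtains p where "trigpoly p" "(L2norm (\<lambda>t. cplx f t - p t))\<^sup>2 < e"
proof -
  interpret finite_measure I01 by (rule finite_measure_I01)
  obtain G :: "nat \<Rightarrow> complex \<Rightarrow> real" where G: "\<And>n. continuous_on (sphere 0 1) (G n)"
    "\<And>n z. \<bar>G n z\<bar> \<le> B" "AE t in I01. (\<lambda>n. G n (\<phi> 1 t)) \<longlonglongrightarrow> f t"
    using bounded_circle_approx[OF assms(1) B] by blast
  have c: "continuous_on {0..1} (\<lambda>t. G n (\<phi> 1 t))" for n
    by (rule continuous_on_compose2[OF G(1)]) (auto intro: continuous_intros)
  have [measurable]: "(\<lambda>t. G n (\<phi> 1 t)) \<in> borel_measurable I01" for n
    by (rule continuous_borel_I01[OF c])
  have L: "(\<lambda>t. of_real (G n (\<phi> 1 t))) \<in> L2" for n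
    by (rule L2_bounded[where B=B]) (auto simp: G)
  have Lf: "cplx f \<in> L2" by (rule L2_bounded[where B=B]) (auto simp: B)
  have "(\<lambda>n. LINT t|I01. (cmod (of_real (f t) - of_real (G n (\<phi> 1 t))))\<^sup>2) \<longlonglongrightarrow> (LINT t|I01. 0)"
  proof (rule integral_dominated_convergence[where w="\<lambda>_. (2 * B)\<^sup>2"])
    show "AE t in I01. (\<lambda>n. (cmod (complex_of_real (f t) - of_real (G n (\<phi> 1 t))))\<^sup>2) \<longlonglongrightarrow> 0"
      using G(3)
    proof eventually_elim
      case (elim t)
      have "(\<lambda>n. (cmod (complex_of_real (f t) - of_real (G n (\<phi> 1 t))))\<^sup>2)
          \<longlonglongrightarrow> (cmod (complex_of_real (f t) - of_real (f t)))\<^sup>2"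
        by (intro tendsto_intros elim)
      then show ?case by simp
    qed
    show "AE t in I01. norm ((cmod (complex_of_real (f t) - of_real (G n (\<phi> 1 t))))\<^sup>2) \<le> (2 * B)\<^sup>2" for n
    proof (rule AE_I2)
      fix t assume "t \<in> space I01"
      then have "\<bar>f t\<bar> \<le> B" using B by simp
      then have "\<bar>f t - G n (\<phi> 1 t)\<bar> \<le> 2 * B" using G(2)[of n "\<phi> 1 t"] by simp
      then show "norm ((cmod (complex_of_real (f t) - of_real (G n (\<phi> 1 t))))\<^sup>2) \<le> (2 * B)\<^sup>2"
        using power_mono[of "\<bar>f t - G n (\<phi> 1 t)\<bar>" "2 * B" 2] by (simp flip: of_real_diff)
    qed
  qed auto
  then have "\<forall>\<^sub>F n in sequentially. (LINT t|I01. (cmod (of_real (f t) - of_real (G n (\<phi> 1 t))))\<^sup>2) < e / 4"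
    by (rule order_tendstoD) (use \<open>e > 0\<close> in simp)
  then obtain n where n: "(L2norm (\<lambda>t. of_real (f t) - of_real (G n (\<phi> 1 t))))\<^sup>2 < e / 4"
    unfolding L2norm_sq eventually_sequentially by blast
  \<comment> \<open>On an interval of length 1 a uniform error below sqrt(e/4) costs at most e/4 in
    squared norm. \<open>L2norm_triangle_sq\<close> doubles both squared errors, and the strict
    bound on the first keeps the total below e.\<close>
  have se: "sqrt (e / 4) > 0" using \<open>e > 0\<close> by simp
  obtain p where p: "trigpoly p" "\<And>t. cmod (of_real (G n (\<phi> 1 t)) - p t) < sqrt (e / 4)"
    using trigpoly_approx_continuous[OF G(1) se] by blast
  have "(L2norm (\<lambda>t. of_real (G n (\<phi> 1 t)) - p t))\<^sup>2 \<le> (LINT t|I01. e / 4)"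
    unfolding L2norm_sq
  proof (rule integral_mono)
    show "integrable I01 (\<lambda>t. (cmod (complex_of_real (G n (\<phi> 1 t)) - p t))\<^sup>2)"
      by (intro L2_square_integrable L2_diff L trigpoly_L2 p)
    show "(cmod (complex_of_real (G n (\<phi> 1 t)) - p t))\<^sup>2 \<le> e / 4" for t
      using power_mono[OF less_imp_le[OF p(2)[of t]], of 2] \<open>e > 0\<close> by simp
  qed simp
  then have 2: "(L2norm (\<lambda>t. of_real (G n (\<phi> 1 t)) - p t))\<^sup>2 \<le> e / 4" by simp
  have "(L2norm (\<lambda>t. cplx f t - p t))\<^sup>2
     \<le> 2 * (L2norm (\<lambda>t. of_real (f t) - of_real (G n (\<phi> 1 t))))\<^sup>2
      + 2 * (L2norm (\<lambda>t. of_real (G n (\<phi> 1 t)) - p t))\<^sup>2"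
    using L2norm_triangle_sq[OF L2_diff[OF Lf L[of n]] L2_diff[OF L[of n] trigpoly_L2[OF p(1)]]] by simp
  then show ?thesis using n 2 that[OF p(1)] by simp
qed

text \<open>Truncation at height n reduces the claim to bounded functions; the truncation error is
  dominated by |f|, whose square is integrable.\<close>

lemma trigpoly_dense:
  assumes f: "f \<in> L2real" and "e > 0"
  obtains p where "trigpoly p" "(L2norm (\<lambda>t. cplx f t - p t))\<^sup>2 < e"
proof -
  have L: "cplx f \<in> L2" using f by (simp add: L2real_def)
  have "(\<lambda>t. Re (cplx f t)) \<in> borel_measurable I01"
    by (rule measurable_compose[OF L2_measurable[OF L] borel_measurable_Re])
  then have [measurable]: "f \<in> borel_measurable I01" by simp
  define T where "T n t = max (- real n) (min (real n) (f t))" for n t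
  have [measurable]: "T n \<in> borel_measurable I01" for n unfolding T_def[abs_def] by measurable
  have T: "\<bar>T n t\<bar> \<le> real n" for n t by (auto simp: T_def)
  have LT: "cplx (T n) \<in> L2" for n
    by (rule L2_bounded[where B="real n"]) (auto simp: T)
  have "(\<lambda>n. LINT t|I01. (cmod (of_real (f t) - of_real (T n t)))\<^sup>2) \<longlonglongrightarrow> (LINT t|I01. 0)"
  proof (rule integral_dominated_convergence[where w="\<lambda>t. (cmod (cplx f t))\<^sup>2"])
    show "AE t in I01. (\<lambda>n. (cmod (complex_of_real (f t) - of_real (T n t)))\<^sup>2) \<longlonglongrightarrow> 0"
    proof (intro AE_I2 tendsto_eventually)
      fix t
      have "\<forall>\<^sub>F n in sequentially. \<bar>f t\<bar> \<le> real n"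
        using filterlim_real_sequentially by (simp add: filterlim_at_top)
      then show "\<forall>\<^sub>F n in sequentially. (cmod (complex_of_real (f t) - of_real (T n t)))\<^sup>2 = 0"
        by eventually_elim (auto simp: T_def)
    qed
    show "AE t in I01. norm ((cmod (complex_of_real (f t) - of_real (T n t)))\<^sup>2) \<le> (cmod (cplx f t))\<^sup>2" for n
    proof (rule AE_I2)
      fix t
      have "\<bar>f t - T n t\<bar> \<le> \<bar>f t\<bar>" by (auto simp: T_def)
      then show "norm ((cmod (complex_of_real (f t) - of_real (T n t)))\<^sup>2) \<le> (cmod (cplx f t))\<^sup>2"
        by (simp flip: of_real_diff add: abs_le_square_iff)
    qed
  qed (auto intro: L2_square_integrable[OF L, simplified])
  then have "\<forall>\<^sub>F n in sequentially. (LINT t|I01. (cmod (of_real (f t) - of_real (T n t)))\<^sup>2) < e / 4"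
    by (rule order_tendstoD) (use \<open>e > 0\<close> in simp)
  then obtain n where n: "(L2norm (\<lambda>t. of_real (f t) - of_real (T n t)))\<^sup>2 < e / 4"
    unfolding L2norm_sq eventually_sequentially by blast
  obtain p where p: "trigpoly p" "(L2norm (\<lambda>t. cplx (T n) t - p t))\<^sup>2 < e / 4"
    using trigpoly_dense_bounded[of "T n" "real n" "e / 4"] T \<open>e > 0\<close> by auto
  have "(L2norm (\<lambda>t. cplx f t - p t))\<^sup>2
     \<le> 2 * (L2norm (\<lambda>t. of_real (f t) - of_real (T n t)))\<^sup>2 + 2 * (L2norm (\<lambda>t. of_real (T n t) - p t))\<^sup>2"
    using L2norm_triangle_sq[OF L2_diff[OF L LT[of n]] L2_diff[OF LT[of n] trigpoly_L2[OF p(1)]]] by simp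
  then show ?thesis using n p(2) that[OF p(1)] by simp
qed

text \<open>Completing the square in every coefficient. Taking for \<open>a\<close> the Fourier
  coefficients gives Bessel's inequality; for general \<open>a\<close> the last sum is nonnegative,
  so no trigonometric polynomial with frequencies in \<open>K\<close> is closer to \<open>f\<close>
  than the partial Fourier sum, which is what Parseval needs.\<close>

lemma L2norm_diff_trigpoly:
  assumes f: "f \<in> L2" and K: "finite K"
  shows "(L2norm (\<lambda>t. f t - (\<Sum>k\<in>K. a k * \<phi> k t)))\<^sup>2
    = (L2norm f)\<^sup>2 - (\<Sum>k\<in>K. (cmod (ip f (\<phi> k)))\<^sup>2) + (\<Sum>k\<in>K. (cmod (ip f (\<phi> k) - a k))\<^sup>2)"
proof -
  define p where "p t = (\<Sum>k\<in>K. a k * \<phi> k t)" for t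
  have p: "p \<in> L2" unfolding p_def[abs_def] by (intro L2_sum L2_cmult L2_phi)
  have ip_p: "ip p g = (\<Sum>k\<in>K. a k * ip (\<phi> k) g)" if "g \<in> L2" for g
    unfolding p_def[abs_def] by (subst ip_sum_left) (auto intro: L2_cmult L2_phi that simp: ip_cmult_left)
  have pk: "ip p (\<phi> k) = a k" if "k \<in> K" for k
    using K that by (simp add: ip_p L2_phi ip_phi_phi of_bool_def if_distrib cong: if_cong)
  have pp: "ip p p = (\<Sum>k\<in>K. a k * cnj (a k))"
    unfolding ip_p[OF p] by (intro sum.cong refl) (metis ip_cnj pk)
  have pf: "ip p f = (\<Sum>k\<in>K. a k * cnj (ip f (\<phi> k)))"
    unfolding ip_p[OF f] ip_cnj ..
  have fp: "ip f p = (\<Sum>k\<in>K. cnj (a k) * ip f (\<phi> k))"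
    unfolding ip_cnj[of p f, symmetric] pf by simp
  have "ip (\<lambda>t. f t - p t) (\<lambda>t. f t - p t) = ip f (\<lambda>t. f t - p t) - ip p (\<lambda>t. f t - p t)"
    using f p L2_diff by (simp add: ip_diff_left)
  also have "\<dots> = cnj (ip f f - ip p f) - cnj (ip f p - ip p p)"
    unfolding ip_diff_left[OF f p f, symmetric] ip_diff_left[OF f p p, symmetric] ip_cnj ..
  also have "\<dots> = ip f f - ip f p - ip p f + ip p p"
    by (simp add: ip_cnj)
  also have "\<dots> = ip f f - (\<Sum>k\<in>K. of_real ((cmod (ip f (\<phi> k)))\<^sup>2)) + (\<Sum>k\<in>K. of_real ((cmod (ip f (\<phi> k) - a k))\<^sup>2))"
    unfolding pp pf fp complex_norm_square
    by (simp add: sum.distrib sum_subtractf algebra_simps)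
  finally have "complex_of_real ((L2norm (\<lambda>t. f t - p t))\<^sup>2) = of_real
     ((L2norm f)\<^sup>2 - (\<Sum>k\<in>K. (cmod (ip f (\<phi> k)))\<^sup>2) + (\<Sum>k\<in>K. (cmod (ip f (\<phi> k) - a k))\<^sup>2))"
    unfolding ip_self_L2norm by simp
  then show ?thesis unfolding of_real_eq_iff p_def .
qed

lemma Bessel_sum:
  assumes "f \<in> L2" "finite K"
  shows "(\<Sum>k\<in>K. (cmod (ip f (\<phi> k)))\<^sup>2) \<le> (L2norm f)\<^sup>2"
  using L2norm_diff_trigpoly[OF assms, of "\<lambda>k. ip f (\<phi> k)"]
    zero_le_power2[of "L2norm (\<lambda>t. f t - (\<Sum>k\<in>K. ip f (\<phi> k) * \<phi> k t))"]
  by simp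

text \<open>Enumerating the integers by \<open>int_decode\<close> turns the integral into a series
  of nonnegative terms, whose partial sums are finite sums over distinct integers.\<close>

lemma nn_integral_count_space_int_le:
  fixes f :: "int \<Rightarrow> ennreal"
  assumes "\<And>K. finite K \<Longrightarrow> sum f K \<le> C"
  shows "(\<integral>\<^sup>+k. f k \<partial>count_space UNIV) \<le> C"
proof -
  have "(\<integral>\<^sup>+k. f k \<partial>count_space UNIV) = (\<integral>\<^sup>+n. f (int_decode n) \<partial>count_space UNIV)"
    by (rule nn_integral_bij_count_space[symmetric, OF bij_int_decode])
  also have "\<dots> = (\<Sum>n. f (int_decode n))" by (rule nn_integral_count_space_nat)
  also have "\<dots> \<le> C"
  proof (rule suminf_le_const)
    show "(\<Sum>i<n. f (int_decode i)) \<le> C" for n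
    proof -
      have "inj_on int_decode {..<n}" by (rule inj_int_decode)
      then have "(\<Sum>i<n. f (int_decode i)) = sum f (int_decode ` {..<n})" by (simp add: sum.reindex)
      then show ?thesis using assms[of "int_decode ` {..<n}"] by simp
    qed
  qed simp
  finally show ?thesis .
qed

lemma sum_le_nn_integral_count_space:
  fixes f :: "'i \<Rightarrow> ennreal"
  assumes "finite K"
  shows "sum f K \<le> (\<integral>\<^sup>+k. f k \<partial>count_space UNIV)"
proof -
  have "sum f K = (\<integral>\<^sup>+k. f k * indicator K k \<partial>count_space UNIV)"
    by (subst nn_integral_count_space_indicator[symmetric])
       (simp_all add: nn_integral_count_space_finite[OF assms] NO_MATCH_def)
  also have "\<dots> \<le> (\<integral>\<^sup>+k. f k \<partial>count_space UNIV)"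
    by (rule nn_integral_mono) (simp add: indicator_def)
  finally show ?thesis .
qed

text \<open>One inequality is Bessel. For the other, a trigonometric polynomial within squared
  distance e of f bounds the squared norm of f by a finite sum of squared coefficients plus e. The
  restriction to real f is inherited from \<open>trigpoly_dense\<close>.\<close>

lemma Parseval:
  assumes f: "f \<in> L2real"
  shows "(\<integral>\<^sup>+k. ennreal ((cmod (ip (cplx f) (\<phi> k)))\<^sup>2) \<partial>count_space UNIV) = ennreal ((L2norm (cplx f))\<^sup>2)"
proof (rule antisym)
  have L: "cplx f \<in> L2" using f by (simp add: L2real_def)
  show "(\<integral>\<^sup>+k. ennreal ((cmod (ip (cplx f) (\<phi> k)))\<^sup>2) \<partial>count_space UNIV) \<le> ennreal ((L2norm (cplx f))\<^sup>2)"
    apply (rule nn_integral_count_space_int_le)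
    apply (subst sum_ennreal, simp)
    apply (rule ennreal_leI)
    by (rule Bessel_sum[OF L])
  show "ennreal ((L2norm (cplx f))\<^sup>2) \<le> (\<integral>\<^sup>+k. ennreal ((cmod (ip (cplx f) (\<phi> k)))\<^sup>2) \<partial>count_space UNIV)"
  proof (rule ennreal_le_epsilon)
    fix e :: real assume "0 < e"
    then obtain p where p: "trigpoly p" "(L2norm (\<lambda>t. cplx f t - p t))\<^sup>2 < e"
      using trigpoly_dense[OF f] by blast
    then obtain K a where K: "finite K" "p = (\<lambda>t. \<Sum>k\<in>K. a k * \<phi> k t)"
      unfolding trigpoly_def by blast
    have "0 \<le> (\<Sum>k\<in>K. (cmod (ip (cplx f) (\<phi> k) - a k))\<^sup>2)" by (intro sum_nonneg) auto
    then have "(L2norm (cplx f))\<^sup>2 \<le> (\<Sum>k\<in>K. (cmod (ip (cplx f) (\<phi> k)))\<^sup>2) + e"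
      using p(2) L2norm_diff_trigpoly[OF L K(1), of a] unfolding K(2) by linarith
    then have "ennreal ((L2norm (cplx f))\<^sup>2) \<le> (\<Sum>k\<in>K. ennreal ((cmod (ip (cplx f) (\<phi> k)))\<^sup>2)) + ennreal e"
      using \<open>0 < e\<close> by (subst sum_ennreal, simp, subst ennreal_plus[symmetric]) (use \<open>0 < e\<close> in \<open>auto intro!: ennreal_leI sum_nonneg\<close>)
    also have "\<dots> \<le> (\<integral>\<^sup>+k. ennreal ((cmod (ip (cplx f) (\<phi> k)))\<^sup>2) \<partial>count_space UNIV) + ennreal e"
      by (intro add_mono sum_le_nn_integral_count_space K) simp
    finally show "ennreal ((L2norm (cplx f))\<^sup>2)
      \<le> (\<integral>\<^sup>+k. ennreal ((cmod (ip (cplx f) (\<phi> k)))\<^sup>2) \<partial>count_space UNIV) + ennreal e" .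
  qed
qed

section \<open>Fourier coefficients of random functions\<close>

lemma space_L2borel [simp]: "space L2borel = L2real"
  unfolding L2borel_def by (rule space_measure_of) auto

lemma L2real_L2: "f \<in> L2real \<Longrightarrow> cplx f \<in> L2"
  by (simp add: L2real_def)

text \<open>The functional is Lipschitz for the seminorm by Cauchy-Schwarz, so the preimage of an
  open set is one of the generators of the sigma-algebra.\<close>

lemma measurable_ip_L2borel:
  assumes h: "h \<in> L2"
  shows "(\<lambda>f. ip (cplx f) h) \<in> borel_measurable L2borel"
proof (rule borel_measurableI)
  fix S :: "complex set" assume S: "open S"
  let ?A = "(\<lambda>f. ip (cplx f) h) -` S \<inter> L2real"
  have "\<exists>e>0. \<forall>g\<in>L2real. L2norm (\<lambda>t. cplx g t - cplx f t) < e \<longrightarrow> g \<in> ?A" if f: "f \<in> ?A" for f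
  proof -
    obtain e where e: "e > 0" "\<And>z. dist z (ip (cplx f) h) < e \<Longrightarrow> z \<in> S"
      using S f unfolding open_dist by blast
    \<comment> \<open>The added 1 keeps the quotient meaningful when \<open>h\<close> vanishes
      almost everywhere.\<close>
    define d where "d = e / (1 + L2norm h)"
    have pos: "1 + L2norm h > 0" using L2norm_nonneg[of h] by linarith
    have "g \<in> ?A" if g: "g \<in> L2real" and gd: "L2norm (\<lambda>t. cplx g t - cplx f t) < d" for g
    proof -
      have L: "cplx g \<in> L2" "cplx f \<in> L2" using g f by (auto intro: L2real_L2)
      have "dist (ip (cplx g) h) (ip (cplx f) h) \<le> L2norm (\<lambda>t. cplx g t - cplx f t) * L2norm h"
        using ip_Cauchy_Schwarz[OF L2_diff[OF L] h] by (simp add: dist_norm ip_diff_left[OF L h])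
      also have "\<dots> \<le> L2norm (\<lambda>t. cplx g t - cplx f t) * (1 + L2norm h)"
        by (intro mult_left_mono L2norm_nonneg) simp
      also have "\<dots> < d * (1 + L2norm h)" by (rule mult_strict_right_mono[OF gd pos])
      also have "\<dots> = e" using pos by (simp add: d_def)
      finally show ?thesis using e(2) g by simp
    qed
    moreover have "d > 0" using e pos by (simp add: d_def)
    ultimately show ?thesis by blast
  qed
  then have "?A \<in> {A. A \<subseteq> L2real \<and> (\<forall>f\<in>A. \<exists>e>0. \<forall>g\<in>L2real. L2norm (\<lambda>t. cplx g t - cplx f t) < e \<longrightarrow> g \<in> A)}"
    by blast
  then show "(\<lambda>f. ip (cplx f) h) -` S \<inter> space L2borel \<in> sets L2borel"
    unfolding space_L2borel by (subst L2borel_def, intro in_measure_of) auto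
qed

locale centered_random_function = prob_space M for M :: "'a measure" +
  fixes V :: "'a \<Rightarrow> real \<Rightarrow> real"
  assumes random_function: "random_function M V"
    and centered: "centered M V"
    and square_integrable: "integrable M (\<lambda>\<omega>. (L2norm (cplx (V \<omega>)))\<^sup>2)"
begin

lemma joint_measurable: "case_prod V \<in> borel_measurable (M \<Otimes>\<^sub>M I01)"
  using random_function by (simp add: random_function_def)

lemma measurable_L2borel: "V \<in> measurable M L2borel"
  using random_function by (simp add: random_function_def)

lemma in_L2real: "\<omega> \<in> space M \<Longrightarrow> V \<omega> \<in> L2real"
  using measurable_space[OF measurable_L2borel] by simp

lemma in_L2: "\<omega> \<in> space M \<Longrightarrow> cplx (V \<omega>) \<in> L2"
  by (intro L2real_L2 in_L2real)

lemma measurable_ip [measurable]: "h \<in> L2 \<Longrightarrow> (\<lambda>\<omega>. ip (cplx (V \<omega>)) h) \<in> borel_measurable M"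
  by (rule measurable_compose[OF measurable_L2borel measurable_ip_L2borel])

lemma measurable_coef [measurable]: "(\<lambda>\<omega>. ip (cplx (V \<omega>)) (\<phi> k)) \<in> borel_measurable M"
  by (rule measurable_ip[OF L2_phi])

lemma norm_ip_sq_le:
  assumes "\<omega> \<in> space M" "h \<in> L2"
  shows "(cmod (ip (cplx (V \<omega>)) h))\<^sup>2 \<le> (L2norm (cplx (V \<omega>)))\<^sup>2 * (L2norm h)\<^sup>2"
  using power_mono[OF ip_Cauchy_Schwarz[OF in_L2[OF assms(1)] assms(2)], of 2]
  by (simp add: power_mult_distrib)

lemma integrable_ip_sq:
  assumes "h \<in> L2"
  shows "integrable M (\<lambda>\<omega>. (cmod (ip (cplx (V \<omega>)) h))\<^sup>2)"
proof (rule Bochner_Integration.integrable_bound)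
  show "integrable M (\<lambda>\<omega>. (L2norm (cplx (V \<omega>)))\<^sup>2 * (L2norm h)\<^sup>2)"
    by (intro integrable_mult_left square_integrable)
  show "(\<lambda>\<omega>. (cmod (ip (cplx (V \<omega>)) h))\<^sup>2) \<in> borel_measurable M"
    using assms by measurable
qed (use norm_ip_sq_le[OF _ assms] in auto)

lemma norm_coef_le:
  assumes "\<omega> \<in> space M"
  shows "cmod (ip (cplx (V \<omega>)) (\<phi> k)) \<le> L2norm (cplx (V \<omega>))"
  using ip_Cauchy_Schwarz[OF in_L2[OF assms] L2_phi[of k]] by (simp add: L2norm_phi)

text \<open>Cauchy-Schwarz against \<open>\<phi> 0\<close>, which is constantly 1. This controls the
  inner integral in the Fubini argument of \<open>expectation_mult_coef\<close>.\<close>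

lemma integral_abs_le:
  assumes "\<omega> \<in> space M"
  shows "(LINT s|I01. \<bar>V \<omega> s\<bar>) \<le> L2norm (cplx (V \<omega>))"
proof -
  have L: "cplx (V \<omega>) \<in> L2" by (rule in_L2[OF assms])
  have m: "(\<lambda>s. complex_of_real \<bar>V \<omega> s\<bar>) \<in> borel_measurable I01"
    using measurable_compose[OF L2_measurable[OF L], of "\<lambda>z. complex_of_real (cmod z)" borel] by simp
  then have La: "(\<lambda>s. complex_of_real \<bar>V \<omega> s\<bar>) \<in> L2"
    using L2_square_integrable[OF L] by (simp add: L2_def)
  have "cmod (ip (\<lambda>s. complex_of_real \<bar>V \<omega> s\<bar>) (\<phi> 0)) \<le> L2norm (\<lambda>s. complex_of_real \<bar>V \<omega> s\<bar>)"
    using ip_Cauchy_Schwarz[OF La L2_phi[of 0]] by (simp add: L2norm_phi)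
  also have "L2norm (\<lambda>s. complex_of_real \<bar>V \<omega> s\<bar>) = L2norm (cplx (V \<omega>))"
    by (simp add: L2norm_def ip_self)
  also have "ip (\<lambda>s. complex_of_real \<bar>V \<omega> s\<bar>) (\<phi> 0) = of_real (LINT s|I01. \<bar>V \<omega> s\<bar>)"
    unfolding ip_def by (simp add: phi_0)
  also have "cmod (of_real (LINT s|I01. \<bar>V \<omega> s\<bar>)) = (LINT s|I01. \<bar>V \<omega> s\<bar>)"
    by simp
  finally show ?thesis .
qed

text \<open>The bridge from pointwise hypotheses to Fourier coefficients: centring, the covariance
  operator and the orthogonality of noise and instrument are all given at fixed points, and all
  reach the coefficients through this exchange of integrals. Joint integrability follows from |A|
  ||V|| \<le> |A|^2 + ||V||^2.\<close>

lemma expectation_mult_coef: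
  assumes [measurable]: "A \<in> borel_measurable M" and A2: "integrable M (\<lambda>\<omega>. (cmod (A \<omega>))\<^sup>2)"
  shows "expectation (\<lambda>\<omega>. A \<omega> * ip (cplx (V \<omega>)) (\<phi> k))
    = (LINT s|I01. expectation (\<lambda>\<omega>. A \<omega> * of_real (V \<omega> s)) * cnj (\<phi> k s))"
proof -
  interpret I: sigma_finite_measure I01 by (rule sigma_finite_I01)
  interpret P: pair_sigma_finite M I01 ..
  define F where "F \<omega> s = A \<omega> * of_real (V \<omega> s) * cnj (\<phi> k s)" for \<omega> s
  have V[measurable]: "(\<lambda>z. V (fst z) (snd z)) \<in> borel_measurable (M \<Otimes>\<^sub>M I01)"
    using joint_measurable by (simp add: case_prod_unfold)
  have [measurable]: "case_prod F \<in> borel_measurable (M \<Otimes>\<^sub>M I01)"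
    unfolding F_def case_prod_unfold by measurable
  have nF: "norm (F \<omega> s) = cmod (A \<omega>) * \<bar>V \<omega> s\<bar>" for \<omega> s
    by (simp add: F_def norm_mult)
  have "integrable (M \<Otimes>\<^sub>M I01) (case_prod F)"
  proof (rule P.Fubini_integrable)
    show "integrable M (\<lambda>\<omega>. LINT s|I01. norm (case_prod F (\<omega>, s)))"
    proof (rule Bochner_Integration.integrable_bound)
      show "integrable M (\<lambda>\<omega>. (cmod (A \<omega>))\<^sup>2 + (L2norm (cplx (V \<omega>)))\<^sup>2)"
        by (intro Bochner_Integration.integrable_add A2 square_integrable)
      show "AE \<omega> in M. norm (LINT s|I01. norm (case_prod F (\<omega>, s)))
         \<le> norm ((cmod (A \<omega>))\<^sup>2 + (L2norm (cplx (V \<omega>)))\<^sup>2)"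
      proof (rule AE_I2)
        fix \<omega> assume w: "\<omega> \<in> space M"
        have "(LINT s|I01. norm (case_prod F (\<omega>, s))) = cmod (A \<omega>) * (LINT s|I01. \<bar>V \<omega> s\<bar>)"
          by (simp add: nF)
        also have "\<dots> \<le> cmod (A \<omega>) * L2norm (cplx (V \<omega>))"
          by (intro mult_left_mono integral_abs_le w) simp
        also have "\<dots> \<le> (cmod (A \<omega>))\<^sup>2 + (L2norm (cplx (V \<omega>)))\<^sup>2" by (rule mult_le_sum_squares)
        finally show "norm (LINT s|I01. norm (case_prod F (\<omega>, s)))
         \<le> norm ((cmod (A \<omega>))\<^sup>2 + (L2norm (cplx (V \<omega>)))\<^sup>2)"
          by simp
      qed
    qed simp
    show "AE \<omega> in M. integrable I01 (\<lambda>s. case_prod F (\<omega>, s))"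
    proof (rule AE_I2)
      fix \<omega> assume "\<omega> \<in> space M"
      from L2_mult_integrable[OF in_L2[OF this] L2_phi[of k]]
      show "integrable I01 (\<lambda>s. case_prod F (\<omega>, s))"
        unfolding F_def by (simp add: mult.assoc)
    qed
  qed simp
  then have "(LINT s|I01. expectation (\<lambda>\<omega>. F \<omega> s)) = expectation (\<lambda>\<omega>. LINT s|I01. F \<omega> s)"
    by (rule P.Fubini_integral)
  moreover have "(LINT s|I01. F \<omega> s) = A \<omega> * ip (cplx (V \<omega>)) (\<phi> k)" for \<omega>
    by (simp add: F_def ip_def mult.assoc)
  moreover have "expectation (\<lambda>\<omega>. F \<omega> s) = expectation (\<lambda>\<omega>. A \<omega> * of_real (V \<omega> s)) * cnj (\<phi> k s)" for s
    by (simp add: F_def)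
  ultimately show ?thesis by simp
qed

lemma expectation_coef: "expectation (\<lambda>\<omega>. ip (cplx (V \<omega>)) (\<phi> k)) = 0"
proof -
  have "expectation (\<lambda>\<omega>. 1 * ip (cplx (V \<omega>)) (\<phi> k))
    = (LINT s|I01. expectation (\<lambda>\<omega>. 1 * of_real (V \<omega> s)) * cnj (\<phi> k s))"
    by (rule expectation_mult_coef) auto
  also have "\<dots> = (LINT s|I01. 0)"
    using centered by (intro Bochner_Integration.integral_cong refl) (auto simp: centered_def)
  finally show ?thesis by simp
qed

lemma coef_var_eq: "coef_var M V k = expectation (\<lambda>\<omega>. (cmod (ip (cplx (V \<omega>)) (\<phi> k)))\<^sup>2)"
  by (simp add: coef_var_def cvar_def expectation_coef)

lemma coef_var_nonneg: "0 \<le> coef_var M V k"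
  unfolding coef_var_eq by (rule integral_nonneg_AE) simp

text \<open>For the normalized coefficient r one has r^4 \<le> 1 + r^8, whence the constant 1 +
  \<eta>; undoing the normalization gives the square of the variance.\<close>

lemma coef_fourth_moment:
  assumes m: "(SUP k. \<integral>\<^sup>+ \<omega>. ennreal (cmod (ip (cplx (V \<omega>)) (\<phi> k) / of_real (sqrt (coef_var M V k))) ^ 8) \<partial>M)
       \<le> ennreal \<eta>" and \<eta>: "0 \<le> \<eta>"
  shows "(\<integral>\<^sup>+\<omega>. ennreal (cmod (ip (cplx (V \<omega>)) (\<phi> k)) ^ 4) \<partial>M) \<le> ennreal ((1 + \<eta>) * (coef_var M V k)\<^sup>2)"
proof (cases "coef_var M V k = 0")
  \<comment> \<open>Division by zero makes the normalized coefficient zero, so the moment hypothesis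
    is silent here. A centred coefficient of zero variance vanishes almost surely, which settles the
    case.\<close>
  case True
  then have "AE \<omega> in M. (cmod (ip (cplx (V \<omega>)) (\<phi> k)))\<^sup>2 = 0"
    unfolding coef_var_eq by (subst (asm) integral_nonneg_eq_0_iff_AE) (auto intro: integrable_ip_sq L2_phi)
  then have "AE \<omega> in M. ennreal (cmod (ip (cplx (V \<omega>)) (\<phi> k)) ^ 4) = 0" by eventually_elim auto
  then have "(\<integral>\<^sup>+\<omega>. ennreal (cmod (ip (cplx (V \<omega>)) (\<phi> k)) ^ 4) \<partial>M) = 0"
    by (subst nn_integral_0_iff_AE) auto
  then show ?thesis by simp
next
  case False
  define v where "v = coef_var M V k"
  have v: "v > 0" using False coef_var_nonneg[of k] by (simp add: v_def)
  define r where "r \<omega> = cmod (ip (cplx (V \<omega>)) (\<phi> k) / of_real (sqrt v))" for \<omega>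
  have [measurable]: "r \<in> borel_measurable M" unfolding r_def[abs_def] by measurable
  have r0: "0 \<le> r \<omega>" for \<omega> by (simp add: r_def)
  have r4: "cmod (ip (cplx (V \<omega>)) (\<phi> k)) ^ 4 \<le> v\<^sup>2 * (1 + r \<omega> ^ 8)" for \<omega>
  proof -
    have "sqrt v ^ 4 = (sqrt v ^ 2) ^ 2" by (simp only: flip: power_mult) simp
    then have s4: "sqrt v ^ 4 = v\<^sup>2" using v by simp
    have "cmod (ip (cplx (V \<omega>)) (\<phi> k)) = sqrt v * r \<omega>"
      using v by (simp add: r_def norm_divide)
    then have "cmod (ip (cplx (V \<omega>)) (\<phi> k)) ^ 4 = v\<^sup>2 * r \<omega> ^ 4"
      by (simp add: power_mult_distrib s4)
    also have "\<dots> \<le> v\<^sup>2 * (1 + r \<omega> ^ 8)"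
    proof (rule mult_left_mono)
      have "r \<omega> ^ 4 * 1 \<le> (r \<omega> ^ 4)\<^sup>2 + 1\<^sup>2" by (rule mult_le_sum_squares)
      then show "r \<omega> ^ 4 \<le> 1 + r \<omega> ^ 8" by (simp flip: power_mult)
    qed simp
    finally show ?thesis .
  qed
  have "(\<integral>\<^sup>+\<omega>. ennreal (cmod (ip (cplx (V \<omega>)) (\<phi> k)) ^ 4) \<partial>M)
      \<le> (\<integral>\<^sup>+\<omega>. ennreal (v\<^sup>2) * (1 + ennreal (r \<omega> ^ 8)) \<partial>M)"
  proof (rule nn_integral_mono)
    fix \<omega>
    have "ennreal (v\<^sup>2 * (1 + r \<omega> ^ 8)) = ennreal (v\<^sup>2) * (1 + ennreal (r \<omega> ^ 8))"
      using r0[of \<omega>] by (simp add: ennreal_mult)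
    then show "ennreal (cmod (ip (cplx (V \<omega>)) (\<phi> k)) ^ 4) \<le> ennreal (v\<^sup>2) * (1 + ennreal (r \<omega> ^ 8))"
      using ennreal_leI[OF r4[of \<omega>]] by simp
  qed
  also have "\<dots> = ennreal (v\<^sup>2) * (1 + (\<integral>\<^sup>+\<omega>. ennreal (r \<omega> ^ 8) \<partial>M))"
    by (simp add: nn_integral_cmult nn_integral_add emeasure_space_1)
  also have "\<dots> \<le> ennreal (v\<^sup>2) * (1 + ennreal \<eta>)"
    using order_trans[OF SUP_upper[OF UNIV_I] m] unfolding r_def v_def
    by (intro mult_left_mono add_left_mono) auto
  also have "\<dots> = ennreal ((1 + \<eta>) * v\<^sup>2)"
    using \<eta> by (simp add: ennreal_mult mult.commute)
  finally show ?thesis by (simp add: v_def)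
qed

text \<open>By Parseval the fourth power of the norm is the double series of products of squared
  coefficients. Cauchy-Schwarz and \<open>coef_fourth_moment\<close> bound each mixed moment by (1 +
  \<eta>) \<open>v j\<close> \<open>v k\<close>, and the variances sum to the expected squared norm,
  so the double series is at most (1 + \<eta>) times the square of that expectation.\<close>

lemma L2norm_fourth_moment:
  assumes m: "(SUP k. \<integral>\<^sup>+ \<omega>. ennreal (cmod (ip (cplx (V \<omega>)) (\<phi> k) / of_real (sqrt (coef_var M V k))) ^ 8) \<partial>M)
       \<le> ennreal \<eta>" and \<eta>: "0 \<le> \<eta>"
  shows "integrable M (\<lambda>\<omega>. (L2norm (cplx (V \<omega>))) ^ 4)"
proof -
  define a where "a k \<omega> = ennreal ((cmod (ip (cplx (V \<omega>)) (\<phi> k)))\<^sup>2)" for k \<omega>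
  define v where "v k = coef_var M V k" for k
  have v0: "0 \<le> v k" for k unfolding v_def by (rule coef_var_nonneg)
  have [measurable]: "a k \<in> borel_measurable M" for k unfolding a_def[abs_def] by measurable
  have a2: "(\<integral>\<^sup>+\<omega>. (a k \<omega>)\<^sup>2 \<partial>M) \<le> ennreal ((1 + \<eta>) * (v k)\<^sup>2)" for k
    using coef_fourth_moment[OF m \<eta>, of k] unfolding a_def v_def
    by (simp add: ennreal_power flip: power_mult)
  have ajk: "(\<integral>\<^sup>+\<omega>. a j \<omega> * a k \<omega> \<partial>M) \<le> ennreal (1 + \<eta>) * (ennreal (v j) * ennreal (v k))" for j k
  proof -
    have "(\<integral>\<^sup>+\<omega>. a j \<omega> * a k \<omega> \<partial>M)\<^sup>2 \<le> (\<integral>\<^sup>+\<omega>. (a j \<omega>)\<^sup>2 \<partial>M) * (\<integral>\<^sup>+\<omega>. (a k \<omega>)\<^sup>2 \<partial>M)"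
      by (rule Cauchy_Schwarz_nn_integral) auto
    also have "\<dots> \<le> ennreal ((1 + \<eta>) * (v j)\<^sup>2) * ennreal ((1 + \<eta>) * (v k)\<^sup>2)"
      by (intro mult_mono a2) auto
    also have "\<dots> = ennreal (((1 + \<eta>) * (v j * v k))\<^sup>2)"
      using \<eta> v0 by (subst ennreal_mult[symmetric]) (auto simp: power2_eq_square mult_ac)
    finally have le: "(\<integral>\<^sup>+\<omega>. a j \<omega> * a k \<omega> \<partial>M)\<^sup>2 \<le> ennreal (((1 + \<eta>) * (v j * v k))\<^sup>2)" .
    \<comment> \<open>A square root is taken in the extended reals; an infinite left side is
      excluded because its square would be infinite.\<close>
    have "(\<integral>\<^sup>+\<omega>. a j \<omega> * a k \<omega> \<partial>M) \<le> ennreal ((1 + \<eta>) * (v j * v k))"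
    proof (cases "\<integral>\<^sup>+\<omega>. a j \<omega> * a k \<omega> \<partial>M")
      case (real r)
      then have "r\<^sup>2 \<le> ((1 + \<eta>) * (v j * v k))\<^sup>2" using le by (simp add: ennreal_power)
      then have "r \<le> (1 + \<eta>) * (v j * v k)"
        by (rule power2_le_imp_le) (use \<eta> v0 in simp)
      then show ?thesis using real by (simp add: ennreal_leI)
    next
      case top
      then show ?thesis using le by (simp add: top_power_ennreal top_unique)
    qed
    then show ?thesis using \<eta> v0 by (simp add: ennreal_mult)
  qed
  have sum_v: "(\<integral>\<^sup>+k. ennreal (v k) \<partial>count_space UNIV) = ennreal (expectation (\<lambda>\<omega>. (L2norm (cplx (V \<omega>)))\<^sup>2))"
  proof -
    have "(\<integral>\<^sup>+k. ennreal (v k) \<partial>count_space UNIV) = (\<integral>\<^sup>+k. (\<integral>\<^sup>+\<omega>. a k \<omega> \<partial>M) \<partial>count_space UNIV)"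
      unfolding v_def coef_var_eq a_def
      by (intro nn_integral_cong nn_integral_eq_integral[symmetric] integrable_ip_sq L2_phi) simp
    also have "\<dots> = (\<integral>\<^sup>+\<omega>. (\<integral>\<^sup>+k. a k \<omega> \<partial>count_space UNIV) \<partial>M)"
      by (rule nn_integral_count_space_nn_integral[symmetric]) auto
    also have "\<dots> = (\<integral>\<^sup>+\<omega>. ennreal ((L2norm (cplx (V \<omega>)))\<^sup>2) \<partial>M)"
      unfolding a_def by (intro nn_integral_cong Parseval in_L2real)
    also have "\<dots> = ennreal (expectation (\<lambda>\<omega>. (L2norm (cplx (V \<omega>)))\<^sup>2))"
      by (rule nn_integral_eq_integral[OF square_integrable]) simp
    finally show ?thesis .
  qed
  have S: "(\<integral>\<^sup>+k. a k \<omega> \<partial>count_space UNIV) = ennreal ((L2norm (cplx (V \<omega>)))\<^sup>2)"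
    if "\<omega> \<in> space M" for \<omega>
    unfolding a_def by (intro Parseval in_L2real that)
  have sq: "(\<lambda>\<omega>. (L2norm (cplx (V \<omega>)))\<^sup>2) \<in> borel_measurable M"
    by (rule borel_measurable_integrable[OF square_integrable])
  \<comment> \<open>Measurability of the series comes from its value: by Parseval it is the squared
    norm, which is integrable and hence measurable.\<close>
  then have [measurable]: "(\<lambda>\<omega>. \<integral>\<^sup>+k. a k \<omega> \<partial>count_space UNIV) \<in> borel_measurable M"
    by (subst measurable_cong[OF S]) auto
  have "(\<integral>\<^sup>+\<omega>. ennreal ((L2norm (cplx (V \<omega>))) ^ 4) \<partial>M)
      = (\<integral>\<^sup>+\<omega>. (\<integral>\<^sup>+j. (\<integral>\<^sup>+k. a j \<omega> * a k \<omega> \<partial>count_space UNIV) \<partial>count_space UNIV) \<partial>M)"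
  proof (rule nn_integral_cong)
    fix \<omega> assume w: "\<omega> \<in> space M"
    show "ennreal ((L2norm (cplx (V \<omega>))) ^ 4)
      = (\<integral>\<^sup>+j. (\<integral>\<^sup>+k. a j \<omega> * a k \<omega> \<partial>count_space UNIV) \<partial>count_space UNIV)"
      by (simp add: nn_integral_cmult nn_integral_multc S[OF w]) (simp flip: ennreal_mult power_add)
  qed
  also have "\<dots> = (\<integral>\<^sup>+j. (\<integral>\<^sup>+\<omega>. (\<integral>\<^sup>+k. a j \<omega> * a k \<omega> \<partial>count_space UNIV) \<partial>M) \<partial>count_space UNIV)"
    by (intro nn_integral_count_space_nn_integral) (auto simp: nn_integral_cmult)
  also have "\<dots> = (\<integral>\<^sup>+j. (\<integral>\<^sup>+k. (\<integral>\<^sup>+\<omega>. a j \<omega> * a k \<omega> \<partial>M) \<partial>count_space UNIV) \<partial>count_space UNIV)"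
    by (intro nn_integral_cong nn_integral_count_space_nn_integral) auto
  also have "\<dots> \<le> (\<integral>\<^sup>+j. (\<integral>\<^sup>+k. ennreal (1 + \<eta>) * (ennreal (v j) * ennreal (v k)) \<partial>count_space UNIV) \<partial>count_space UNIV)"
    by (intro nn_integral_mono ajk)
  also have "\<dots> = ennreal (1 + \<eta>) * (ennreal (expectation (\<lambda>\<omega>. (L2norm (cplx (V \<omega>)))\<^sup>2)) * ennreal (expectation (\<lambda>\<omega>. (L2norm (cplx (V \<omega>)))\<^sup>2)))"
    by (simp add: nn_integral_cmult nn_integral_multc sum_v)
  also have "\<dots> < \<infinity>" by (simp add: ennreal_mult_less_top)
  finally have fin: "(\<integral>\<^sup>+\<omega>. ennreal ((L2norm (cplx (V \<omega>))) ^ 4) \<partial>M) < \<infinity>" .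
  have "(\<lambda>\<omega>. ((L2norm (cplx (V \<omega>)))\<^sup>2)\<^sup>2) \<in> borel_measurable M"
    using sq by (rule borel_measurable_power)
  then show ?thesis
    using fin by (intro integrableI_bounded) (simp_all flip: power_mult)
qed

end

text \<open>Expand the square of the sum: by independence and centring the off-diagonal terms
  vanish, and n equal diagonal terms remain. Since F is any function of one observation, the same
  lemma serves \<open>cross_term\<close>, \<open>power_term\<close> and
  \<open>error_term\<close>.\<close>

lemma iid_mean_square:
  fixes F :: "'s \<Rightarrow> complex"
  assumes iid: "iid_sample P S n Z M Z\<^sub>0" and n: "n \<ge> 1"
    and Z0[measurable]: "Z\<^sub>0 \<in> measurable M S" and F[measurable]: "F \<in> borel_measurable S"
    and F2: "integrable M (\<lambda>\<omega>. (cmod (F (Z\<^sub>0 \<omega>)))\<^sup>2)" and F0: "(LINT \<omega>|M. F (Z\<^sub>0 \<omega>)) = 0"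
  shows "(\<integral>\<^sup>+\<omega>. ennreal ((cmod (1 / of_nat n * (\<Sum>i=1..n. F (Z i \<omega>))))\<^sup>2) \<partial>P)
    = ennreal ((LINT \<omega>|M. (cmod (F (Z\<^sub>0 \<omega>)))\<^sup>2) / n)"
proof -
  interpret P: prob_space P using iid by (simp add: iid_sample_def)
  have indep: "P.indep_vars (\<lambda>_. S) Z {1..n}"
    and distr: "\<And>i. i \<in> {1..n} \<Longrightarrow> distr P S (Z i) = distr M S Z\<^sub>0"
    using iid by (auto simp: iid_sample_def)
  have Z[measurable]: "Z i \<in> measurable P S" if "i \<in> {1..n}" for i
    using indep that by (simp add: P.indep_vars_def2)
  define f where "f i \<omega> = F (Z i \<omega>)" for i \<omega>
  have fm: "f i \<in> borel_measurable P" if "i \<in> {1..n}" for i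
    unfolding f_def[abs_def] using Z[OF that] by measurable
  have f2: "integrable P (\<lambda>\<omega>. (cmod (f i \<omega>))\<^sup>2)" if "i \<in> {1..n}" for i
  proof -
    have "integrable (distr M S Z\<^sub>0) (\<lambda>z. (cmod (F z))\<^sup>2)"
      using F2 by (subst integrable_distr_eq) auto
    then show ?thesis
      unfolding distr[OF that, symmetric] f_def using Z[OF that] by (subst (asm) integrable_distr_eq) auto
  qed
  have Ef2: "(LINT \<omega>|P. (cmod (f i \<omega>))\<^sup>2) = (LINT \<omega>|M. (cmod (F (Z\<^sub>0 \<omega>)))\<^sup>2)" if "i \<in> {1..n}" for i
  proof -
    have "(LINT \<omega>|P. (cmod (f i \<omega>))\<^sup>2) = (LINT z|distr P S (Z i). (cmod (F z))\<^sup>2)"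
      unfolding f_def using Z[OF that] by (subst integral_distr) auto
    then show ?thesis unfolding distr[OF that] by (subst (asm) integral_distr) auto
  qed
  have Ef: "(LINT \<omega>|P. f i \<omega>) = 0" if "i \<in> {1..n}" for i
  proof -
    have "(LINT \<omega>|P. f i \<omega>) = (LINT z|distr P S (Z i). F z)"
      unfolding f_def using Z[OF that] by (subst integral_distr) auto
    then show ?thesis unfolding distr[OF that] F0[symmetric] by (subst (asm) integral_distr) auto
  qed
  have f1: "integrable P (f i)" if "i \<in> {1..n}" for i
    using integrable_mult_of_squares[of "f i" P "\<lambda>_. 1"] fm[OF that] f2[OF that] by simp
  have ii: "integrable P (\<lambda>\<omega>. f i \<omega> * cnj (f j \<omega>))" if "i \<in> {1..n}" "j \<in> {1..n}" for i j
    using fm f2 that by (intro integrable_mult_of_squares) auto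
  have cross: "(LINT \<omega>|P. f i \<omega> * cnj (f j \<omega>)) = 0" if ij: "i \<in> {1..n}" "j \<in> {1..n}" "i \<noteq> j" for i j
  proof -
    \<comment> \<open>Conjugating only the factor with index j makes the product over
      \<open>{i, j}\<close> the desired mixed term, in the form in which independence factorizes an
      expectation.\<close>
    define G where "G l z = (if l = i then F z else cnj (F z))" for l z
    have "P.indep_vars (\<lambda>_. S) Z {i, j}"
      by (rule P.indep_vars_subset[OF indep]) (use ij in auto)
    then have iv: "P.indep_vars (\<lambda>_. borel) (\<lambda>l \<omega>. G l (Z l \<omega>)) {i, j}"
      by (rule P.indep_vars_compose2) (auto simp: G_def[abs_def])
    have "(LINT \<omega>|P. (\<Prod>l\<in>{i, j}. G l (Z l \<omega>))) = (\<Prod>l\<in>{i, j}. LINT \<omega>|P. G l (Z l \<omega>))"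
    proof (rule P.indep_vars_lebesgue_integral[OF _ iv])
      show "integrable P (\<lambda>\<omega>. G l (Z l \<omega>))" if "l \<in> {i, j}" for l
        using f1[of l] that ij by (auto simp: G_def f_def[abs_def])
    qed simp
    also have "\<dots> = 0" using ij Ef[of i] by (simp add: G_def f_def)
    finally show ?thesis using ij by (simp add: G_def f_def)
  qed
  define s where "s \<omega> = (\<Sum>i=1..n. \<Sum>j=1..n. Re (f i \<omega> * cnj (f j \<omega>)))" for \<omega>
  have s_eq: "(cmod (\<Sum>i=1..n. f i \<omega>))\<^sup>2 = s \<omega>" for \<omega>
  proof -
    have "complex_of_real ((cmod (\<Sum>i=1..n. f i \<omega>))\<^sup>2) = (\<Sum>i=1..n. \<Sum>j=1..n. f i \<omega> * cnj (f j \<omega>))"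
      unfolding complex_norm_square by (simp add: sum_product)
    from arg_cong[OF this, of Re] show ?thesis unfolding s_def by simp
  qed
  have int_s: "integrable P s"
    unfolding s_def[abs_def]
    by (intro Bochner_Integration.integrable_sum integrable_Re ii)
  have "(LINT \<omega>|P. s \<omega>) = (\<Sum>i=1..n. \<Sum>j=1..n. Re (LINT \<omega>|P. f i \<omega> * cnj (f j \<omega>)))"
  proof -
    have r: "integrable P (\<lambda>\<omega>. Re (f i \<omega> * cnj (f j \<omega>)))" if "i \<in> {1..n}" "j \<in> {1..n}" for i j
      by (intro integrable_Re ii that)
    have "(LINT \<omega>|P. s \<omega>) = (\<Sum>i=1..n. LINT \<omega>|P. (\<Sum>j=1..n. Re (f i \<omega> * cnj (f j \<omega>))))"
      unfolding s_def by (intro Bochner_Integration.integral_sum Bochner_Integration.integrable_sum r)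
    also have "\<dots> = (\<Sum>i=1..n. \<Sum>j=1..n. LINT \<omega>|P. Re (f i \<omega> * cnj (f j \<omega>)))"
      by (intro sum.cong refl Bochner_Integration.integral_sum r)
    also have "\<dots> = (\<Sum>i=1..n. \<Sum>j=1..n. Re (LINT \<omega>|P. f i \<omega> * cnj (f j \<omega>)))"
      by (intro sum.cong refl integral_Re ii)
    finally show ?thesis .
  qed
  also have "\<dots> = (\<Sum>i=1..n. \<Sum>j=1..n. if i = j then (LINT \<omega>|M. (cmod (F (Z\<^sub>0 \<omega>)))\<^sup>2) else 0)"
  proof (intro sum.cong refl)
    fix i j assume i: "i \<in> {1..n}" and j: "j \<in> {1..n}"
    have "(LINT \<omega>|P. f i \<omega> * cnj (f i \<omega>)) = of_real (LINT \<omega>|P. (cmod (f i \<omega>))\<^sup>2)"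
      by (simp add: complex_norm_square[symmetric] flip: integral_complex_of_real)
    then show "Re (LINT \<omega>|P. f i \<omega> * cnj (f j \<omega>)) = (if i = j then (LINT \<omega>|M. (cmod (F (Z\<^sub>0 \<omega>)))\<^sup>2) else 0)"
      using cross[OF i j] Ef2[OF i] by auto
  qed
  also have "\<dots> = n * (LINT \<omega>|M. (cmod (F (Z\<^sub>0 \<omega>)))\<^sup>2)" by simp
  finally have Es: "(LINT \<omega>|P. s \<omega>) = n * (LINT \<omega>|M. (cmod (F (Z\<^sub>0 \<omega>)))\<^sup>2)" .
  have e: "(cmod (1 / of_nat n * (\<Sum>i=1..n. F (Z i \<omega>))))\<^sup>2 = s \<omega> / (real n)\<^sup>2" for \<omega>
    unfolding s_eq[symmetric] f_def by (simp add: norm_mult norm_divide power_divide)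
  have "(\<integral>\<^sup>+\<omega>. ennreal (s \<omega> / (real n)\<^sup>2) \<partial>P) = ennreal (LINT \<omega>|P. s \<omega> / (real n)\<^sup>2)"
    by (intro nn_integral_eq_integral integrable_divide_zero int_s) (simp flip: s_eq)
  also have "(LINT \<omega>|P. s \<omega> / (real n)\<^sup>2) = (LINT \<omega>|M. (cmod (F (Z\<^sub>0 \<omega>)))\<^sup>2) / n"
    using n by (simp add: Es power2_eq_square)
  finally show ?thesis unfolding e .
qed

section \<open>Stationary pairs\<close>

locale stationary_model = prob_space M for M :: "'a measure" +
  fixes X W :: "'a \<Rightarrow> real \<Rightarrow> real"
  assumes class_F: "(X, W) \<in> class_F M"
begin

sublocale X: centered_random_function M X
  using class_F by unfold_locales (auto simp: class_F_def)

sublocale W: centered_random_function M W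
  using class_F by unfold_locales (auto simp: class_F_def)

lemma integrable_W_sq: "t \<in> {0..1} \<Longrightarrow> integrable M (\<lambda>\<omega>. (W \<omega> t)\<^sup>2)"
  using class_F by (auto simp: class_F_def stationary_pair_def)

lemma measurable_W_at [measurable]: "t \<in> {0..1} \<Longrightarrow> (\<lambda>\<omega>. W \<omega> t) \<in> borel_measurable M"
  using W.centered by (auto simp: centered_def)

lemma cov_eq:
  "t \<in> {0..1} \<Longrightarrow> s \<in> {0..1} \<Longrightarrow> cov M (\<lambda>\<omega>. X \<omega> t) (\<lambda>\<omega>. W \<omega> s) = expectation (\<lambda>\<omega>. X \<omega> t * W \<omega> s)"
  using X.centered W.centered by (simp add: cov_def centered_def)

text \<open>Fubini produces the covariance integrated against the conjugate exponential. The
  covariance is real, so conjugating the whole identity puts \<open>\<phi> j\<close> itself under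
  the integral.\<close>

lemma cross_cov_op_phi_eq:
  assumes s: "s \<in> {0..1}"
  shows "expectation (\<lambda>\<omega>. ip (\<phi> j) (cplx (X \<omega>)) * of_real (W \<omega> s)) = cross_cov_op M X W (\<phi> j) s"
proof -
  have "expectation (\<lambda>\<omega>. of_real (W \<omega> s) * ip (cplx (X \<omega>)) (\<phi> j))
    = (LINT t|I01. expectation (\<lambda>\<omega>. of_real (W \<omega> s) * of_real (X \<omega> t)) * cnj (\<phi> j t))"
    by (rule X.expectation_mult_coef) (use s integrable_W_sq in auto)
  also have "\<dots> = (LINT t|I01. of_real (cov M (\<lambda>\<omega>. X \<omega> t) (\<lambda>\<omega>. W \<omega> s)) * cnj (\<phi> j t))"
  proof (intro Bochner_Integration.integral_cong refl)
    fix t assume "t \<in> space I01"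
    then have "cov M (\<lambda>\<omega>. X \<omega> t) (\<lambda>\<omega>. W \<omega> s) = expectation (\<lambda>\<omega>. W \<omega> s * X \<omega> t)"
      using s by (simp add: cov_eq mult.commute)
    then show "expectation (\<lambda>\<omega>. of_real (W \<omega> s) * of_real (X \<omega> t)) * cnj (\<phi> j t)
      = of_real (cov M (\<lambda>\<omega>. X \<omega> t) (\<lambda>\<omega>. W \<omega> s)) * cnj (\<phi> j t)"
      by (simp flip: of_real_mult)
  qed
  finally have "cnj (expectation (\<lambda>\<omega>. of_real (W \<omega> s) * ip (cplx (X \<omega>)) (\<phi> j)))
    = cnj (LINT t|I01. of_real (cov M (\<lambda>\<omega>. X \<omega> t) (\<lambda>\<omega>. W \<omega> s)) * cnj (\<phi> j t))"
    by simp
  then show ?thesis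
    unfolding cross_cov_op_def Bochner_Integration.integral_cnj[symmetric]
    by (simp add: ip_cnj mult.commute)
qed

text \<open>A second use of Fubini, now in s, leaves the operator applied to \<open>\<phi> j\<close>
  and paired with \<open>\<phi> k\<close>; the eigenvalue equation and orthonormality finish. The
  orthogonality of the cross moments is thus derived from the operator form of the
  hypothesis.\<close>

lemma cross_moment:
  "expectation (\<lambda>\<omega>. ip (\<phi> j) (cplx (X \<omega>)) * ip (cplx (W \<omega>)) (\<phi> k)) = c_coef M X W j * of_bool (j = k)"
proof -
  have ipX: "ip (\<phi> j) (cplx (X \<omega>)) = cnj (ip (cplx (X \<omega>)) (\<phi> j))" for \<omega> by (simp add: ip_cnj)
  have "expectation (\<lambda>\<omega>. ip (\<phi> j) (cplx (X \<omega>)) * ip (cplx (W \<omega>)) (\<phi> k))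
    = (LINT s|I01. expectation (\<lambda>\<omega>. ip (\<phi> j) (cplx (X \<omega>)) * of_real (W \<omega> s)) * cnj (\<phi> k s))"
  proof (rule W.expectation_mult_coef)
    show "(\<lambda>\<omega>. ip (\<phi> j) (cplx (X \<omega>))) \<in> borel_measurable M" unfolding ipX by measurable
    show "integrable M (\<lambda>\<omega>. (cmod (ip (\<phi> j) (cplx (X \<omega>))))\<^sup>2)"
      unfolding ipX using X.integrable_ip_sq[OF L2_phi[of j]] by simp
  qed
  also have "\<dots> = (LINT s|I01. cross_cov_op M X W (\<phi> j) s * cnj (\<phi> k s))"
    by (intro Bochner_Integration.integral_cong refl) (simp add: cross_cov_op_phi_eq)
  also have "\<dots> = (LINT s|I01. c_coef M X W j * (\<phi> j s * cnj (\<phi> k s)))"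
  proof (rule integral_cong_AE)
    \<comment> \<open>The eigenvalue equation holds only almost everywhere, so the operator image
      has to be known measurable before it is replaced; as an expectation with parameter s of a
      jointly measurable function it is.\<close>
    have "(\<lambda>s. expectation (\<lambda>\<omega>. ip (\<phi> j) (cplx (X \<omega>)) * of_real (W \<omega> s))) \<in> borel_measurable I01"
    proof (rule borel_measurable_lebesgue_integral)
      have W: "(\<lambda>z. W (snd z) (fst z)) \<in> borel_measurable (I01 \<Otimes>\<^sub>M M)"
        using measurable_compose[OF measurable_pair_swap' W.joint_measurable]
        by (simp add: case_prod_unfold)
      show "(\<lambda>(s, \<omega>). ip (\<phi> j) (cplx (X \<omega>)) * of_real (W \<omega> s)) \<in> borel_measurable (I01 \<Otimes>\<^sub>M M)"
        unfolding case_prod_unfold ipX using W by measurable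
    qed
    then have "cross_cov_op M X W (\<phi> j) \<in> borel_measurable I01"
      by (subst measurable_cong[OF cross_cov_op_phi_eq[symmetric]]) auto
    then show "(\<lambda>s. cross_cov_op M X W (\<phi> j) s * cnj (\<phi> k s)) \<in> borel_measurable I01" by measurable
    have "AE s in I01. cross_cov_op M X W (\<phi> j) s = c_coef M X W j * \<phi> j s"
      using class_F by (simp add: class_F_def)
    then show "AE s in I01. cross_cov_op M X W (\<phi> j) s * cnj (\<phi> k s) = c_coef M X W j * (\<phi> j s * cnj (\<phi> k s))"
      by eventually_elim (simp add: mult.assoc)
  qed measurable
  also have "\<dots> = c_coef M X W j * ip (\<phi> j) (\<phi> k)" by (simp add: ip_def)
  finally show ?thesis by (simp add: ip_phi_phi)
qed

text \<open>Otherwise \<open>\<phi> k\<close> would be annihilated by the operator, and injectivity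
  would make a function of norm 1 vanish almost everywhere.\<close>

lemma c_coef_nonzero: "c_coef M X W k \<noteq> 0"
proof
  assume c: "c_coef M X W k = 0"
  have "AE s in I01. cross_cov_op M X W (\<phi> k) s = c_coef M X W k * \<phi> k s"
    using class_F by (simp add: class_F_def)
  then have "AE s in I01. cross_cov_op M X W (\<phi> k) s = 0" by (simp add: c)
  then have "AE t in I01. \<phi> k t = 0"
    using class_F L2_phi[of k] unfolding class_F_def by blast
  then have "AE t in I01. \<phi> k t * cnj (\<phi> k t) = 0" by eventually_elim simp
  then have "ip (\<phi> k) (\<phi> k) = 0" unfolding ip_def by (rule integral_eq_zero_AE)
  then show False by (simp add: ip_phi_phi)
qed

lemma measurable_L2norm [measurable]:
  "(\<lambda>\<omega>. L2norm (cplx (X \<omega>))) \<in> borel_measurable M" "(\<lambda>\<omega>. L2norm (cplx (W \<omega>))) \<in> borel_measurable M"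
proof -
  show "(\<lambda>\<omega>. L2norm (cplx (X \<omega>))) \<in> borel_measurable M"
    using measurable_compose[OF borel_measurable_integrable[OF X.square_integrable] borel_measurable_sqrt]
    by (simp add: L2norm_nonneg)
  show "(\<lambda>\<omega>. L2norm (cplx (W \<omega>))) \<in> borel_measurable M"
    using measurable_compose[OF borel_measurable_integrable[OF W.square_integrable] borel_measurable_sqrt]
    by (simp add: L2norm_nonneg)
qed

lemma integrable_L2norm_prod: "integrable M (\<lambda>\<omega>. L2norm (cplx (X \<omega>)) * L2norm (cplx (W \<omega>)))"
  by (rule integrable_mult_of_squares) (auto simp: X.square_integrable W.square_integrable)

text \<open>Continuity of the cross moment in f, with Lipschitz constant E(||X|| ||W||); this is
  what allows the passage from trigonometric polynomials to a general slope.\<close>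

lemma cross_moment_bound:
  assumes f: "f \<in> L2"
  shows "integrable M (\<lambda>\<omega>. ip f (cplx (X \<omega>)) * ip (cplx (W \<omega>)) (\<phi> k))"
    and "cmod (expectation (\<lambda>\<omega>. ip f (cplx (X \<omega>)) * ip (cplx (W \<omega>)) (\<phi> k)))
      \<le> L2norm f * expectation (\<lambda>\<omega>. L2norm (cplx (X \<omega>)) * L2norm (cplx (W \<omega>)))"
proof -
  have ipX: "ip f (cplx (X \<omega>)) = cnj (ip (cplx (X \<omega>)) f)" for \<omega> by (simp add: ip_cnj)
  have [measurable]: "(\<lambda>\<omega>. ip f (cplx (X \<omega>))) \<in> borel_measurable M"
    unfolding ipX using f by measurable
  have b: "cmod (ip f (cplx (X \<omega>)) * ip (cplx (W \<omega>)) (\<phi> k))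
      \<le> L2norm f * (L2norm (cplx (X \<omega>)) * L2norm (cplx (W \<omega>)))" if "\<omega> \<in> space M" for \<omega>
  proof -
    have "cmod (ip f (cplx (X \<omega>)) * ip (cplx (W \<omega>)) (\<phi> k))
      \<le> (L2norm f * L2norm (cplx (X \<omega>))) * L2norm (cplx (W \<omega>))"
      unfolding norm_mult
      by (intro mult_mono ip_Cauchy_Schwarz f X.in_L2 W.norm_coef_le that mult_nonneg_nonneg L2norm_nonneg norm_ge_zero)
    then show ?thesis by (simp add: mult.assoc)
  qed
  have i: "integrable M (\<lambda>\<omega>. L2norm f * (L2norm (cplx (X \<omega>)) * L2norm (cplx (W \<omega>))))"
    by (intro integrable_mult_right integrable_L2norm_prod)
  show 1: "integrable M (\<lambda>\<omega>. ip f (cplx (X \<omega>)) * ip (cplx (W \<omega>)) (\<phi> k))"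
  proof (rule Bochner_Integration.integrable_bound[OF i])
    show "AE \<omega> in M. norm (ip f (cplx (X \<omega>)) * ip (cplx (W \<omega>)) (\<phi> k))
      \<le> norm (L2norm f * (L2norm (cplx (X \<omega>)) * L2norm (cplx (W \<omega>))))"
      using b by (intro AE_I2) (auto simp: L2norm_nonneg abs_mult)
  qed measurable
  have "cmod (expectation (\<lambda>\<omega>. ip f (cplx (X \<omega>)) * ip (cplx (W \<omega>)) (\<phi> k)))
    \<le> expectation (\<lambda>\<omega>. L2norm f * (L2norm (cplx (X \<omega>)) * L2norm (cplx (W \<omega>))))"
    by (rule order_trans[OF integral_norm_bound]) (intro integral_mono integrable_norm 1 i b)
  then show "cmod (expectation (\<lambda>\<omega>. ip f (cplx (X \<omega>)) * ip (cplx (W \<omega>)) (\<phi> k)))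
      \<le> L2norm f * expectation (\<lambda>\<omega>. L2norm (cplx (X \<omega>)) * L2norm (cplx (W \<omega>)))"
    by simp
qed

text \<open>Both sides are linear and continuous in f and agree on exponentials by
  \<open>cross_moment\<close>, hence on trigonometric polynomials, which are dense. For the slope
  this is the identity that centres the error term.\<close>

lemma cross_moment_L2:
  assumes f: "f \<in> L2real"
  shows "expectation (\<lambda>\<omega>. ip (cplx f) (cplx (X \<omega>)) * ip (cplx (W \<omega>)) (\<phi> k))
    = ip (cplx f) (\<phi> k) * c_coef M X W k" (is "?L (cplx f) = ?R (cplx f)")
proof (rule ccontr)
  assume "?L (cplx f) \<noteq> ?R (cplx f)"
  define d where "d = cmod (?L (cplx f) - ?R (cplx f))"
  \<comment> \<open>The sum of the Lipschitz constants of the two sides. Approximating f within d /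
    (1 + C) changes their difference by at most d C / (1 + C), which is less than d; the 1 makes
    this strict and the quotient legitimate.\<close>
  define C where "C = expectation (\<lambda>\<omega>. L2norm (cplx (X \<omega>)) * L2norm (cplx (W \<omega>))) + cmod (c_coef M X W k)"
  have d: "d > 0" using \<open>?L (cplx f) \<noteq> ?R (cplx f)\<close> by (simp add: d_def)
  have C: "C \<ge> 0" unfolding C_def
    by (intro add_nonneg_nonneg integral_nonneg_AE) (auto intro!: mult_nonneg_nonneg L2norm_nonneg)
  have "(d / (1 + C))\<^sup>2 > 0" using d C by (intro zero_less_power divide_pos_pos) auto
  then obtain p where p: "trigpoly p" "(L2norm (\<lambda>t. cplx f t - p t))\<^sup>2 < (d / (1 + C))\<^sup>2"
    using trigpoly_dense[OF f] by blast
  have L: "cplx f \<in> L2" "p \<in> L2" by (auto intro: L2real_L2 f trigpoly_L2 p)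
  obtain K a where K: "finite K" "p = (\<lambda>t. \<Sum>j\<in>K. a j * \<phi> j t)"
    using p(1) unfolding trigpoly_def by blast
  have ipp: "ip p g = (\<Sum>j\<in>K. a j * ip (\<phi> j) g)" if "g \<in> L2" for g
    unfolding K by (subst ip_sum_left) (auto intro: L2_cmult L2_phi that simp: ip_cmult_left)
  have "?L p = expectation (\<lambda>\<omega>. \<Sum>j\<in>K. a j * (ip (\<phi> j) (cplx (X \<omega>)) * ip (cplx (W \<omega>)) (\<phi> k)))"
    by (intro Bochner_Integration.integral_cong refl)
       (simp add: ipp[OF X.in_L2] sum_distrib_right mult.assoc)
  also have "\<dots> = (\<Sum>j\<in>K. a j * (c_coef M X W j * of_bool (j = k)))"
    by (subst Bochner_Integration.integral_sum)
       (auto intro!: integrable_mult_right cross_moment_bound(1) L2_phi simp: cross_moment)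
  also have "\<dots> = (\<Sum>j\<in>K. a j * of_bool (j = k)) * c_coef M X W k"
    by (auto simp: sum_distrib_right intro!: sum.cong)
  also have "\<dots> = ?R p" by (simp add: ipp[OF L2_phi] ip_phi_phi)
  finally have Lp: "?L p = ?R p" .
  have diff: "?L (\<lambda>t. cplx f t - p t) = ?L (cplx f) - ?L p"
  proof -
    have "?L (\<lambda>t. cplx f t - p t) = expectation (\<lambda>\<omega>. ip (cplx f) (cplx (X \<omega>)) * ip (cplx (W \<omega>)) (\<phi> k)
        - ip p (cplx (X \<omega>)) * ip (cplx (W \<omega>)) (\<phi> k))"
      by (intro Bochner_Integration.integral_cong refl)
         (simp add: ip_diff_left[OF L X.in_L2] left_diff_distrib)
    also have "\<dots> = ?L (cplx f) - ?L p"
      by (intro Bochner_Integration.integral_diff cross_moment_bound(1) L)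
    finally show ?thesis .
  qed
  have Rdiff: "?R (\<lambda>t. cplx f t - p t) = ?R (cplx f) - ?R p"
    by (simp add: ip_diff_left[OF L L2_phi] left_diff_distrib)
  have "d = cmod (?L (\<lambda>t. cplx f t - p t) - ?R (\<lambda>t. cplx f t - p t))"
    unfolding d_def diff Rdiff Lp by simp
  also have "\<dots> \<le> cmod (?L (\<lambda>t. cplx f t - p t)) + cmod (?R (\<lambda>t. cplx f t - p t))"
    by (rule norm_triangle_ineq4)
  also have "\<dots> \<le> L2norm (\<lambda>t. cplx f t - p t) * expectation (\<lambda>\<omega>. L2norm (cplx (X \<omega>)) * L2norm (cplx (W \<omega>)))
     + L2norm (\<lambda>t. cplx f t - p t) * 1 * cmod (c_coef M X W k)"
    unfolding norm_mult
    using ip_Cauchy_Schwarz[OF L2_diff[OF L] L2_phi[of k]]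
    by (intro add_mono mult_right_mono cross_moment_bound(2) L2_diff L) (auto simp: L2norm_phi)
  also have "\<dots> = L2norm (\<lambda>t. cplx f t - p t) * C"
    by (simp add: C_def distrib_left)
  also have "\<dots> \<le> (d / (1 + C)) * C"
  proof (rule mult_right_mono[OF _ C])
    show "L2norm (\<lambda>t. cplx f t - p t) \<le> d / (1 + C)"
      by (rule power2_le_imp_le[OF less_imp_le[OF p(2)]]) (use d C in simp)
  qed
  also have "\<dots> < d"
  proof -
    have "d * C < d * (1 + C)" using d by simp
    then show ?thesis using C by (simp add: pos_divide_less_eq)
  qed
  finally show False by simp
qed

text \<open>A coefficient of W with zero variance vanishes almost surely and would force
  \<open>c_coef\<close> to be zero.\<close>

lemma coef_var_W_pos: "coef_var M W k > 0"
proof (rule ccontr)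
  assume "\<not> coef_var M W k > 0"
  then have "coef_var M W k = 0" using W.coef_var_nonneg[of k] by simp
  then have "AE \<omega> in M. (cmod (ip (cplx (W \<omega>)) (\<phi> k)))\<^sup>2 = 0"
    unfolding W.coef_var_eq by (subst (asm) integral_nonneg_eq_0_iff_AE) (auto intro: W.integrable_ip_sq L2_phi)
  then have "AE \<omega> in M. ip (\<phi> k) (cplx (X \<omega>)) * ip (cplx (W \<omega>)) (\<phi> k) = 0" by eventually_elim simp
  then have "c_coef M X W k = 0" unfolding c_coef_def by (rule integral_eq_zero_AE)
  then show False using c_coef_nonzero by blast
qed

end

section \<open>The weights, and finiteness of the sums that define the estimator\<close>

lemma gamma_powr_pos: "\<gamma> k powr r > 0"
proof -
  have "\<gamma> k > 0" unfolding \<gamma>_def by (rule add_pos_nonneg) auto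
  then show ?thesis by simp
qed

lemma gamma_powr_mono: "r \<le> r' \<Longrightarrow> \<gamma> k powr r \<le> \<gamma> k powr r'"
  by (rule powr_mono) (auto simp: \<gamma>_def)

text \<open>By Bessel the sum of \<open>w_hat\<close> over any finite set of frequencies is at most
  \<open>C\<close>, the mean squared norm of the instruments, so at most \<open>C / \<alpha>\<close>
  frequencies reach the threshold.\<close>

lemma finite_w_hat_ge:
  assumes w: "\<And>i. i \<in> {1..n} \<Longrightarrow> w i \<in> L2real" and "\<alpha> > 0"
  shows "finite {k. w_hat n w k \<ge> \<alpha>}"
proof (rule ccontr)
  assume inf: "infinite {k. w_hat n w k \<ge> \<alpha>}"
  define C where "C = 1 / real n * (\<Sum>i=1..n. (L2norm (cplx (w i)))\<^sup>2)"
  obtain K where K: "K \<subseteq> {k. w_hat n w k \<ge> \<alpha>}" "finite K" "card K = nat \<lceil>C / \<alpha>\<rceil> + 1"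
    using infinite_arbitrarily_large[OF inf] by blast
  have "real (card K) * \<alpha> = (\<Sum>k\<in>K. \<alpha>)" by simp
  also have "\<dots> \<le> (\<Sum>k\<in>K. w_hat n w k)" using K by (intro sum_mono) auto
  also have "\<dots> = 1 / real n * (\<Sum>i=1..n. \<Sum>k\<in>K. (cmod (ip (cplx (w i)) (\<phi> k)))\<^sup>2)"
    unfolding w_hat_def by (subst sum.swap) (simp add: sum_distrib_left)
  also have "\<dots> \<le> C" unfolding C_def
    by (intro mult_left_mono sum_mono Bessel_sum L2real_L2 w K) auto
  finally have "real (card K) \<le> C / \<alpha>" using \<open>\<alpha> > 0\<close> by (simp add: field_simps)
  then show False using K(3) by linarith
qed

lemma trig_infsum_finite:
  assumes "finite K" "\<And>k. k \<notin> K \<Longrightarrow> a k = 0"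
  shows "(\<lambda>t. \<Sum>\<^sub>\<infinity>k. a k * \<phi> k t) = (\<lambda>t. \<Sum>k\<in>K. a k * \<phi> k t)"
proof
  fix t
  have "(\<Sum>\<^sub>\<infinity>k. a k * \<phi> k t) = (\<Sum>\<^sub>\<infinity>k\<in>K. a k * \<phi> k t)"
    using assms by (intro infsum_cong_neutral) auto
  then show "(\<Sum>\<^sub>\<infinity>k. a k * \<phi> k t) = (\<Sum>k\<in>K. a k * \<phi> k t)" using assms by simp
qed

text \<open>With finitely many nonzero coefficients the infinite sum is a trigonometric polynomial,
  so its coefficients can be read off by orthonormality. This applies to both \<open>W_hat\<close>
  and \<open>beta_hat\<close>.\<close>

lemma trig_infsum:
  assumes "finite K" "\<And>k. k \<notin> K \<Longrightarrow> a k = 0"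
  shows "(\<lambda>t. \<Sum>\<^sub>\<infinity>k. a k * \<phi> k t) \<in> L2"
    and "ip (\<lambda>t. \<Sum>\<^sub>\<infinity>k. a k * \<phi> k t) (\<phi> j) = a j"
proof -
  have eq: "(\<lambda>t. \<Sum>\<^sub>\<infinity>k. a k * \<phi> k t) = (\<lambda>t. \<Sum>k\<in>K. a k * \<phi> k t)"
    using assms by (rule trig_infsum_finite)
  have "(\<lambda>t. \<Sum>k\<in>K. a k * \<phi> k t) \<in> L2" by (intro L2_sum L2_cmult L2_phi)
  then show "(\<lambda>t. \<Sum>\<^sub>\<infinity>k. a k * \<phi> k t) \<in> L2" by (simp only: eq)
  have "ip (\<lambda>t. \<Sum>k\<in>K. a k * \<phi> k t) (\<phi> j) = (\<Sum>k\<in>K. a k * of_bool (k = j))"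
    by (subst ip_sum_left) (auto intro: L2_cmult L2_phi simp: ip_cmult_left ip_phi_phi)
  also have "\<dots> = a j"
    using assms by (cases "j \<in> K") (auto simp: of_bool_def if_distrib cong: if_cong)
  finally show "ip (\<lambda>t. \<Sum>\<^sub>\<infinity>k. a k * \<phi> k t) (\<phi> j) = a j"
    using eq by simp
qed

section \<open>The coefficients of the estimator\<close>

definition h_hat :: "nat \<Rightarrow> (nat \<Rightarrow> real) \<Rightarrow> (nat \<Rightarrow> real \<Rightarrow> real) \<Rightarrow> int \<Rightarrow> complex" where
  "h_hat n y w k = 1 / of_nat n * (\<Sum>i=1..n. of_real (y i) * ip (cplx (w i)) (\<phi> k))"

text \<open>A condition on two numbers rather than on a sample, so that \<open>not_kept_le\<close>
  can be a deterministic inequality. The second conjunct is the threshold on \<open>lam_hat\<close>,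
  with its value from \<open>lam_hat_eq\<close> inserted and the weight moved to the left.\<close>

definition kept :: "real \<Rightarrow> real \<Rightarrow> complex \<Rightarrow> real \<Rightarrow> int \<Rightarrow> bool" where
  "kept \<nu> \<alpha> c w k \<longleftrightarrow> \<alpha> \<le> w \<and> \<alpha> * \<gamma> k powr \<nu> \<le> (cmod c)\<^sup>2 / w"

context
  fixes \<alpha> :: real and n :: nat and x w :: "nat \<Rightarrow> real \<Rightarrow> real"
  assumes \<alpha>: "\<alpha> > 0" and w: "\<And>i. i \<in> {1..n} \<Longrightarrow> w i \<in> L2real"
begin

lemma ip_W_hat:
  assumes "i \<in> {1..n}"
  shows "ip (W_hat \<alpha> n x w i) (\<phi> k)
    = cnj (c_hat n x w k) / of_real (w_hat n w k) * of_bool (w_hat n w k \<ge> \<alpha>) * ip (cplx (w i)) (\<phi> k)"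
  unfolding W_hat_def[abs_def]
  by (rule trig_infsum(2)[OF finite_w_hat_ge[OF w \<alpha>]]) auto

text \<open>Every coefficient of \<open>W_hat\<close> is that of the instrument times one factor
  common to all observations; its squared modulus has \<open>w_hat\<close> squared below, and
  averaging restores one power of \<open>w_hat\<close>.\<close>

lemma lam_hat_eq:
  "lam_hat \<alpha> n x w k = of_bool (w_hat n w k \<ge> \<alpha>) * ((cmod (c_hat n x w k))\<^sup>2 / w_hat n w k)"
proof -
  define r where "r = (cmod (c_hat n x w k) / w_hat n w k)\<^sup>2 * of_bool (w_hat n w k \<ge> \<alpha>)"
  have "(cmod (ip (W_hat \<alpha> n x w i) (\<phi> k)))\<^sup>2 = r * (cmod (ip (cplx (w i)) (\<phi> k)))\<^sup>2" if "i \<in> {1..n}" for i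
    unfolding ip_W_hat[OF that] r_def
    by (simp add: norm_mult norm_divide power_mult_distrib power_divide of_bool_def)
  then have "lam_hat \<alpha> n x w k = r * w_hat n w k"
    unfolding lam_hat_def w_hat_def by (simp add: sum_distrib_left)
  then show ?thesis unfolding r_def using \<alpha> by (auto simp: power2_eq_square field_simps)
qed

lemma g_hat_eq:
  "g_hat \<alpha> n y x w k
    = cnj (c_hat n x w k) / of_real (w_hat n w k) * of_bool (w_hat n w k \<ge> \<alpha>) * h_hat n y w k"
  unfolding g_hat_def h_hat_def by (simp add: ip_W_hat sum_distrib_left mult_ac)

lemma beta_hat_coef:
  "(beta_hat \<nu> \<alpha> n y x w \<in> L2)"
  "ip (beta_hat \<nu> \<alpha> n y x w) (\<phi> k)
    = (if kept \<nu> \<alpha> (c_hat n x w k) (w_hat n w k) k then h_hat n y w k / c_hat n x w k else 0)"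
proof -
  define b where "b k = g_hat \<alpha> n y x w k / of_real (lam_hat \<alpha> n x w k)
        * of_bool (lam_hat \<alpha> n x w k / \<gamma> k powr \<nu> \<ge> \<alpha>)" for k
  have eq: "beta_hat \<nu> \<alpha> n y x w = (\<lambda>t. \<Sum>\<^sub>\<infinity>k. b k * \<phi> k t)"
    unfolding beta_hat_def[abs_def] b_def ..
  have b0: "b k = 0" if "k \<notin> {k. w_hat n w k \<ge> \<alpha>}" for k
    using that by (simp add: b_def lam_hat_eq)
  show "beta_hat \<nu> \<alpha> n y x w \<in> L2"
    unfolding eq by (rule trig_infsum(1)[OF finite_w_hat_ge[OF w \<alpha>] b0])
  have "ip (beta_hat \<nu> \<alpha> n y x w) (\<phi> k) = b k"
    unfolding eq by (rule trig_infsum(2)[OF finite_w_hat_ge[OF w \<alpha>] b0])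
  also have "b k = (if kept \<nu> \<alpha> (c_hat n x w k) (w_hat n w k) k then h_hat n y w k / c_hat n x w k else 0)"
  proof (cases "kept \<nu> \<alpha> (c_hat n x w k) (w_hat n w k) k")
    case True
    have wk: "\<alpha> \<le> w_hat n w k" and ck: "\<alpha> * \<gamma> k powr \<nu> \<le> (cmod (c_hat n x w k))\<^sup>2 / w_hat n w k"
      using True by (auto simp: kept_def)
    have "0 < \<alpha> * \<gamma> k powr \<nu>" using \<alpha> gamma_powr_pos by simp
    then have c0: "c_hat n x w k \<noteq> 0" using ck by auto
    have w0: "w_hat n w k > 0" using wk \<alpha> by simp
    have "\<alpha> \<le> lam_hat \<alpha> n x w k / \<gamma> k powr \<nu>"
      unfolding pos_le_divide_eq[OF gamma_powr_pos] using ck by (simp add: lam_hat_eq wk)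
    then have "b k = (cnj (c_hat n x w k) / of_real (w_hat n w k) * h_hat n y w k)
       / (c_hat n x w k * cnj (c_hat n x w k) / of_real (w_hat n w k))"
      using wk by (simp add: b_def g_hat_eq lam_hat_eq complex_norm_square del: of_real_power)
    then show ?thesis using True c0 w0 by (simp add: field_simps)
  next
    case False
    \<comment> \<open>When \<open>w_hat\<close> misses its threshold, \<open>lam_hat\<close> is 0
      and hence below the positive threshold as well, so the test on \<open>lam_hat\<close> detects
      both failures.\<close>
    have "\<not> \<alpha> \<le> lam_hat \<alpha> n x w k / \<gamma> k powr \<nu>"
      unfolding pos_le_divide_eq[OF gamma_powr_pos]
      using False \<alpha> gamma_powr_pos[of k \<nu>]
      by (cases "\<alpha> \<le> w_hat n w k") (auto simp: lam_hat_eq kept_def not_le)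
    then show ?thesis using False by (simp add: b_def)
  qed
  finally show "ip (beta_hat \<nu> \<alpha> n y x w) (\<phi> k)
    = (if kept \<nu> \<alpha> (c_hat n x w k) (w_hat n w k) k then h_hat n y w k / c_hat n x w k else 0)" .
qed

lemma coef_error_bound:
  assumes f: "f \<in> L2"
  shows "\<gamma> k powr \<nu> * (cmod (ip (\<lambda>t. beta_hat \<nu> \<alpha> n y x w t - f t) (\<phi> k)))\<^sup>2
    \<le> (cmod (h_hat n y w k - ip f (\<phi> k) * c_hat n x w k))\<^sup>2 / \<alpha>\<^sup>2
      + \<gamma> k powr \<nu> * (cmod (ip f (\<phi> k)))\<^sup>2 * of_bool (\<not> kept \<nu> \<alpha> (c_hat n x w k) (w_hat n w k) k)"
proof -
  have ip: "ip (\<lambda>t. beta_hat \<nu> \<alpha> n y x w t - f t) (\<phi> k)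
    = (if kept \<nu> \<alpha> (c_hat n x w k) (w_hat n w k) k then h_hat n y w k / c_hat n x w k else 0) - ip f (\<phi> k)"
    by (simp add: ip_diff_left[OF beta_hat_coef(1) f L2_phi] beta_hat_coef(2))
  show ?thesis
  proof (cases "kept \<nu> \<alpha> (c_hat n x w k) (w_hat n w k) k")
    case True
    have wk: "\<alpha> \<le> w_hat n w k" and ck: "\<alpha> * \<gamma> k powr \<nu> \<le> (cmod (c_hat n x w k))\<^sup>2 / w_hat n w k"
      using True by (auto simp: kept_def)
    define g where "g = \<gamma> k powr \<nu>"
    have g: "0 < g" unfolding g_def by (rule gamma_powr_pos)
    have w0: "w_hat n w k > 0" using wk \<alpha> by simp
    \<comment> \<open>Each threshold contributes one factor \<alpha>; the weight g is kept so that
      it cancels the weight of the norm below.\<close>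
    have "\<alpha>\<^sup>2 * g = (\<alpha> * g) * \<alpha>" by (simp add: power2_eq_square)
    also have "\<dots> \<le> (\<alpha> * g) * w_hat n w k"
      using wk \<alpha> g by (intro mult_left_mono) auto
    also have "\<dots> \<le> (cmod (c_hat n x w k))\<^sup>2"
      using ck w0 unfolding g_def by (simp add: pos_le_divide_eq)
    finally have c2: "\<alpha>\<^sup>2 * g \<le> (cmod (c_hat n x w k))\<^sup>2" .
    have pos: "0 < \<alpha>\<^sup>2 * g" using \<alpha> g by simp
    then have c0: "c_hat n x w k \<noteq> 0" using c2 by auto
    define D where "D = (cmod (h_hat n y w k - ip f (\<phi> k) * c_hat n x w k))\<^sup>2"
    have "h_hat n y w k / c_hat n x w k - ip f (\<phi> k) = (h_hat n y w k - ip f (\<phi> k) * c_hat n x w k) / c_hat n x w k"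
      using c0 by (simp add: field_simps)
    then have "(cmod (h_hat n y w k / c_hat n x w k - ip f (\<phi> k)))\<^sup>2 = D / (cmod (c_hat n x w k))\<^sup>2"
      by (simp add: D_def norm_divide power_divide)
    also have "\<dots> \<le> D / (\<alpha>\<^sup>2 * g)"
      using c2 pos c0 by (intro divide_left_mono mult_pos_pos) (auto simp: D_def g)
    finally have "g * (cmod (h_hat n y w k / c_hat n x w k - ip f (\<phi> k)))\<^sup>2 \<le> g * (D / (\<alpha>\<^sup>2 * g))"
      using g by (intro mult_left_mono) auto
    also have "\<dots> = D / \<alpha>\<^sup>2" using g by simp
    finally show ?thesis using True by (simp add: ip g_def D_def)
  next
    case False
    then show ?thesis by (simp add: ip)
  qed
qed

end

text \<open>Chebyshev's inequality in pointwise form. If w' is within w/2 of w and c' within |c|/2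
  of c, both thresholds are passed; otherwise one of the two terms on the right is already at least
  1. Integrating this bounds the probability without forming the events.\<close>

lemma not_kept_le:
  assumes c: "c \<noteq> 0" and w: "w > 0" and \<alpha>: "\<alpha> > 0" and "\<alpha> \<le> w / 2"
    and ag: "\<alpha> * \<gamma> k powr \<nu> \<le> (cmod c)\<^sup>2 / (8 * w)"
  shows "of_bool (\<not> kept \<nu> \<alpha> c' w' k) \<le> 4 / w\<^sup>2 * \<bar>w' - w\<bar>\<^sup>2 + 4 / (cmod c)\<^sup>2 * (cmod (c' - c))\<^sup>2"
proof (cases "\<bar>w' - w\<bar> < w / 2 \<and> cmod (c' - c) < cmod c / 2")
  case True
  then have w': "w / 2 < w'" "w' < 2 * w" by (auto simp: abs_if split: if_splits)
  have "cmod c \<le> cmod c' + cmod (c' - c)"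
    by (metis norm_minus_commute norm_triangle_sub)
  then have "cmod c / 2 \<le> cmod c'" using True by simp
  then have c2: "(cmod c / 2)\<^sup>2 \<le> (cmod c')\<^sup>2" by (intro power_mono) auto
  \<comment> \<open>The 8 is a 4 from squaring |c|/2 times a 2 from w' < 2 w.\<close>
  have "(cmod c)\<^sup>2 / (8 * w) = (cmod c / 2)\<^sup>2 / (2 * w)" by (simp add: power_divide)
  also have "\<dots> \<le> (cmod c')\<^sup>2 / w'"
    using w' w c2 by (intro frac_le) auto
  finally have "kept \<nu> \<alpha> c' w' k" using w' ag \<open>\<alpha> \<le> w / 2\<close> by (simp add: kept_def)
  then show ?thesis by simp
next
  case False
  have "1 \<le> 4 / w\<^sup>2 * \<bar>w' - w\<bar>\<^sup>2 + 4 / (cmod c)\<^sup>2 * (cmod (c' - c))\<^sup>2"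
  proof (cases "\<bar>w' - w\<bar> < w / 2")
    case True
    then have "(cmod c / 2)\<^sup>2 \<le> (cmod (c' - c))\<^sup>2" using False by (intro power_mono) auto
    then have "1 \<le> 4 / (cmod c)\<^sup>2 * (cmod (c' - c))\<^sup>2"
      using c by (simp add: power_divide field_simps)
    moreover have "0 \<le> 4 / w\<^sup>2 * \<bar>w' - w\<bar>\<^sup>2" by simp
    ultimately show ?thesis by linarith
  next
    case False
    then have "(w / 2)\<^sup>2 \<le> \<bar>w' - w\<bar>\<^sup>2" using w by (intro power_mono) auto
    then have "1 \<le> 4 / w\<^sup>2 * \<bar>w' - w\<bar>\<^sup>2"
      using w by (simp add: power_divide field_simps)
    moreover have "0 \<le> 4 / (cmod c)\<^sup>2 * (cmod (c' - c))\<^sup>2" by simp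
    ultimately show ?thesis by linarith
  qed
  then show ?thesis by (simp add: of_bool_def)
qed

section \<open>Moments of the empirical terms\<close>

abbreviation (input) data_space :: "(real \<times> (real \<Rightarrow> real) \<times> (real \<Rightarrow> real)) measure" where
  "data_space \<equiv> borel \<Otimes>\<^sub>M L2borel \<Otimes>\<^sub>M L2borel"

definition cross_term :: "int \<Rightarrow> real \<times> (real \<Rightarrow> real) \<times> (real \<Rightarrow> real) \<Rightarrow> complex" where
  "cross_term k z = ip (\<phi> k) (cplx (fst (snd z))) * ip (cplx (snd (snd z))) (\<phi> k)"

text \<open>Real in nature, but embedded in the complex numbers so that
  \<open>iid_mean_square\<close> applies to it as to the other terms.\<close>

definition power_term :: "int \<Rightarrow> real \<times> (real \<Rightarrow> real) \<times> (real \<Rightarrow> real) \<Rightarrow> complex" where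
  "power_term k z = of_real ((cmod (ip (cplx (snd (snd z))) (\<phi> k)))\<^sup>2)"

definition error_term :: "complex \<Rightarrow> int \<Rightarrow> real \<times> (real \<Rightarrow> real) \<times> (real \<Rightarrow> real) \<Rightarrow> complex" where
  "error_term b k z = of_real (fst z) * ip (cplx (snd (snd z))) (\<phi> k) - b * cross_term k z"

lemma measurable_terms [measurable]:
  "cross_term k \<in> borel_measurable data_space"
  "power_term k \<in> borel_measurable data_space"
  "error_term b k \<in> borel_measurable data_space"
proof -
  note [measurable] = measurable_ip_L2borel[OF L2_phi]
  have x: "(\<lambda>z. ip (\<phi> k) (cplx (fst (snd z)))) \<in> borel_measurable data_space"
    unfolding ip_cnj[of _ "\<phi> k", symmetric] by measurable
  show "cross_term k \<in> borel_measurable data_space"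
    unfolding cross_term_def[abs_def] using x by measurable
  then show "error_term b k \<in> borel_measurable data_space"
    unfolding error_term_def[abs_def] by measurable
  show "power_term k \<in> borel_measurable data_space"
    unfolding power_term_def[abs_def] by measurable
qed

section \<open>Estimation errors as empirical means of functions of one observation\<close>

lemma mean_diff_const: "n \<ge> 1 \<Longrightarrow> 1 / of_nat n * (\<Sum>i=1..n. f i) - c = 1 / of_nat n * (\<Sum>i=1..n. f i - (c :: complex))"
  by (simp add: sum_subtractf field_simps)

lemma c_hat_error: "n \<ge> 1 \<Longrightarrow>
  c_hat n x w k - c = 1 / of_nat n * (\<Sum>i=1..n. cross_term k (y i, x i, w i) - c)"
  unfolding c_hat_def by (subst mean_diff_const) (simp_all add: cross_term_def)

lemma w_hat_error: "n \<ge> 1 \<Longrightarrow>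
  of_real (w_hat n w k - v) = 1 / of_nat n * (\<Sum>i=1..n. power_term k (y i, x i, w i) - of_real v)"
  unfolding w_hat_def by (subst mean_diff_const[symmetric]) (simp_all add: power_term_def)

lemma h_hat_error:
  "h_hat n y w k - b * c_hat n x w k = 1 / of_nat n * (\<Sum>i=1..n. error_term b k (y i, x i, w i))"
  unfolding h_hat_def c_hat_def
  by (simp add: error_term_def cross_term_def sum_subtractf sum_distrib_left right_diff_distrib mult_ac)

lemma integrable_norm_diff_const_sq:
  fixes f :: "'x \<Rightarrow> complex"
  assumes "finite_measure M" and [measurable]: "f \<in> borel_measurable M"
    and f: "integrable M (\<lambda>\<omega>. (cmod (f \<omega>))\<^sup>2)"
  shows "integrable M (\<lambda>\<omega>. (cmod (f \<omega> - c))\<^sup>2)"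
proof (rule Bochner_Integration.integrable_bound)
  interpret finite_measure M by fact
  show "integrable M (\<lambda>\<omega>. 2 * (cmod (f \<omega>))\<^sup>2 + 2 * (cmod c)\<^sup>2)"
    by (intro Bochner_Integration.integrable_add integrable_mult_right f integrable_const)
  have "(cmod (f \<omega> - c))\<^sup>2 \<le> 2 * (cmod (f \<omega>))\<^sup>2 + 2 * (cmod c)\<^sup>2" for \<omega>
    using norm_add_sq_le[of "f \<omega>" "- c"] by simp
  then show "AE \<omega> in M. norm ((cmod (f \<omega> - c))\<^sup>2) \<le> norm (2 * (cmod (f \<omega>))\<^sup>2 + 2 * (cmod c)\<^sup>2)"
    by (intro AE_I2) auto
qed measurable

text \<open>The moment classes are condensed into three fourth moments. They suffice because the
  square of each empirical summand is dominated by products of two squares among the norms of X and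
  W and the noise.\<close>

locale instrumental_regression = stationary_model M X W
  for M :: "'a measure" and X W :: "'a \<Rightarrow> real \<Rightarrow> real" +
  fixes U Y :: "'a \<Rightarrow> real" and \<beta> :: "real \<Rightarrow> real" and \<sigma> :: real
  assumes slope: "\<beta> \<in> L2real"
    and X4: "integrable M (\<lambda>\<omega>. (L2norm (cplx (X \<omega>))) ^ 4)"
    and W4: "integrable M (\<lambda>\<omega>. (L2norm (cplx (W \<omega>))) ^ 4)"
    and U_measurable [measurable]: "U \<in> borel_measurable M"
    and U4: "integrable M (\<lambda>\<omega>. (U \<omega>) ^ 4)"
    and orthogonal: "\<And>t. t \<in> {0..1} \<Longrightarrow> expectation (\<lambda>\<omega>. U \<omega> * W \<omega> t) = 0"
    and response: "\<And>\<omega>. \<omega> \<in> space M \<Longrightarrow> Y \<omega> = (LINT t|I01. \<beta> t * X \<omega> t) + \<sigma> * U \<omega>"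
begin

abbreviation Z :: "'a \<Rightarrow> real \<times> (real \<Rightarrow> real) \<times> (real \<Rightarrow> real)" where
  "Z \<equiv> (\<lambda>\<omega>. (Y \<omega>, X \<omega>, W \<omega>))"

abbreviation b :: "int \<Rightarrow> complex" where
  "b k \<equiv> ip (cplx \<beta>) (\<phi> k)"

lemma slope_L2: "cplx \<beta> \<in> L2"
  by (rule L2real_L2[OF slope])

lemma response_cplx:
  assumes "\<omega> \<in> space M"
  shows "of_real (Y \<omega>) = ip (cplx \<beta>) (cplx (X \<omega>)) + of_real \<sigma> * of_real (U \<omega>)"
proof -
  have "ip (cplx \<beta>) (cplx (X \<omega>)) = of_real (LINT t|I01. \<beta> t * X \<omega> t)"
    unfolding ip_def by (simp flip: of_real_mult)
  then show ?thesis using response[OF assms] by simp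
qed

lemma measurable_response [measurable]: "Y \<in> borel_measurable M"
proof -
  have [measurable]: "(\<lambda>\<omega>. ip (cplx (X \<omega>)) (cplx \<beta>)) \<in> borel_measurable M"
    by (rule X.measurable_ip[OF slope_L2])
  have "Y \<omega> = Re (ip (cplx (X \<omega>)) (cplx \<beta>)) + \<sigma> * U \<omega>" if "\<omega> \<in> space M" for \<omega>
    using arg_cong[OF response_cplx[OF that], of Re]
    by (simp add: ip_cnj[of "cplx (X \<omega>)" "cplx \<beta>", symmetric])
  then show ?thesis by (subst measurable_cong) auto
qed

lemma measurable_Z [measurable]: "Z \<in> measurable M data_space"
  using X.measurable_L2borel W.measurable_L2borel by measurable

lemma U_sq_integrable: "integrable M (\<lambda>\<omega>. (U \<omega>)\<^sup>2)"
  using integrable_mult_of_squares[of "\<lambda>\<omega>. (U \<omega>)\<^sup>2" M "\<lambda>_. 1"] U4 by (simp flip: power_mult)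

lemma integrable_sq_prod:
  "integrable M (\<lambda>\<omega>. (L2norm (cplx (X \<omega>)))\<^sup>2 * (L2norm (cplx (W \<omega>)))\<^sup>2)"
  "integrable M (\<lambda>\<omega>. (U \<omega>)\<^sup>2 * (L2norm (cplx (W \<omega>)))\<^sup>2)"
  by (rule integrable_mult_of_squares; use X4 W4 U4 in \<open>simp flip: power_mult\<close>)+

lemma cross_term_sq: "integrable M (\<lambda>\<omega>. (cmod (cross_term k (Z \<omega>)))\<^sup>2)"
proof (rule Bochner_Integration.integrable_bound[OF integrable_sq_prod(1)])
  have "(cmod (cross_term k (Z \<omega>)))\<^sup>2 \<le> (L2norm (cplx (X \<omega>)))\<^sup>2 * (L2norm (cplx (W \<omega>)))\<^sup>2"
    if "\<omega> \<in> space M" for \<omega>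
  proof -
    have "cmod (cross_term k (Z \<omega>)) \<le> L2norm (cplx (X \<omega>)) * L2norm (cplx (W \<omega>))"
      using X.norm_coef_le[OF that, of k] W.norm_coef_le[OF that, of k]
      by (simp add: cross_term_def norm_mult ip_cnj[of "cplx (X \<omega>)", symmetric] mult_mono L2norm_nonneg)
    from power_mono[OF this, of 2] show ?thesis by (simp add: power_mult_distrib)
  qed
  then show "AE \<omega> in M. norm ((cmod (cross_term k (Z \<omega>)))\<^sup>2)
     \<le> norm ((L2norm (cplx (X \<omega>)))\<^sup>2 * (L2norm (cplx (W \<omega>)))\<^sup>2)"
    by (intro AE_I2) auto
qed measurable

lemma power_term_sq: "integrable M (\<lambda>\<omega>. (cmod (power_term k (Z \<omega>)))\<^sup>2)"
proof (rule Bochner_Integration.integrable_bound[OF W4])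
  have "(cmod (power_term k (Z \<omega>)))\<^sup>2 \<le> (L2norm (cplx (W \<omega>))) ^ 4" if "\<omega> \<in> space M" for \<omega>
    using power_mono[OF W.norm_coef_le[OF that, of k], of 4]
    by (simp add: power_term_def norm_power flip: power_mult)
  then show "AE \<omega> in M. norm ((cmod (power_term k (Z \<omega>)))\<^sup>2) \<le> norm ((L2norm (cplx (W \<omega>))) ^ 4)"
    by (intro AE_I2) auto
qed measurable

lemma expectation_cross_term: "expectation (\<lambda>\<omega>. cross_term k (Z \<omega>)) = c_coef M X W k"
  by (simp add: cross_term_def c_coef_def)

lemma expectation_power_term: "expectation (\<lambda>\<omega>. power_term k (Z \<omega>)) = of_real (coef_var M W k)"
  by (simp add: power_term_def W.coef_var_eq del: of_real_power)

lemma integrable_U_coef: "integrable M (\<lambda>\<omega>. of_real (U \<omega>) * ip (cplx (W \<omega>)) (\<phi> k))"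
  using U_sq_integrable W.integrable_ip_sq[OF L2_phi[of k]]
  by (intro integrable_mult_of_squares) auto

lemma expectation_U_coef: "expectation (\<lambda>\<omega>. of_real (U \<omega>) * ip (cplx (W \<omega>)) (\<phi> k)) = 0"
proof -
  have "expectation (\<lambda>\<omega>. of_real (U \<omega>) * ip (cplx (W \<omega>)) (\<phi> k))
    = (LINT s|I01. expectation (\<lambda>\<omega>. of_real (U \<omega>) * of_real (W \<omega> s)) * cnj (\<phi> k s))"
    using U_sq_integrable by (intro W.expectation_mult_coef) auto
  also have "\<dots> = (LINT s|I01. 0)"
    using orthogonal by (intro Bochner_Integration.integral_cong refl) (simp flip: of_real_mult)
  finally show ?thesis by simp
qed

text \<open>Split the response into <\<beta>,X> and noise. The first part contributes b_k c_k by
  \<open>cross_moment_L2\<close>, exactly what the subtracted cross term contributes; the noise part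
  vanishes by \<open>expectation_U_coef\<close>.\<close>

lemma expectation_error_term: "expectation (\<lambda>\<omega>. error_term (b k) k (Z \<omega>)) = 0"
proof -
  have "expectation (\<lambda>\<omega>. error_term (b k) k (Z \<omega>))
    = expectation (\<lambda>\<omega>. (ip (cplx \<beta>) (cplx (X \<omega>)) * ip (cplx (W \<omega>)) (\<phi> k)
        + of_real \<sigma> * (of_real (U \<omega>) * ip (cplx (W \<omega>)) (\<phi> k))) - b k * cross_term k (Z \<omega>))"
    by (intro Bochner_Integration.integral_cong refl)
       (simp add: error_term_def response_cplx algebra_simps)
  also have "\<dots> = (expectation (\<lambda>\<omega>. ip (cplx \<beta>) (cplx (X \<omega>)) * ip (cplx (W \<omega>)) (\<phi> k))
      + of_real \<sigma> * expectation (\<lambda>\<omega>. of_real (U \<omega>) * ip (cplx (W \<omega>)) (\<phi> k)))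
      - b k * expectation (\<lambda>\<omega>. cross_term k (Z \<omega>))"
  proof -
    note i = cross_moment_bound(1)[OF slope_L2, of k] integrable_mult_right[OF integrable_U_coef[of k], of "of_real \<sigma>"]
    have c: "integrable M (\<lambda>\<omega>. b k * cross_term k (Z \<omega>))"
      using cross_moment_bound(1)[OF L2_phi, of k k] by (simp add: cross_term_def)
    show ?thesis
      by (simp add: Bochner_Integration.integral_diff[OF Bochner_Integration.integrable_add[OF i] c]
          Bochner_Integration.integral_add[OF i])
  qed
  also have "\<dots> = 0"
    by (simp add: cross_moment_L2[OF slope] expectation_U_coef expectation_cross_term)
  finally show ?thesis .
qed

text \<open>With B = ||\<beta>|| ||X||, the factor multiplying the coefficient of W in
  \<open>error_term\<close> is at most 2B + |\<sigma> U|: one B from the response, one from the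
  subtracted term. Its square is at most 8 B^2 + 2 \<sigma>^2 U^2. The point is that this does not
  depend on k.\<close>

definition envelope :: "'a \<Rightarrow> real" where
  "envelope \<omega> = 8 * (L2norm (cplx \<beta>))\<^sup>2 * (L2norm (cplx (X \<omega>)))\<^sup>2 + 2 * \<sigma>\<^sup>2 * (U \<omega>)\<^sup>2"

lemma envelope_nonneg: "0 \<le> envelope \<omega>"
  by (simp add: envelope_def)

lemma integrable_envelope: "integrable M (\<lambda>\<omega>. envelope \<omega> * (L2norm (cplx (W \<omega>)))\<^sup>2)"
proof -
  have "integrable M (\<lambda>\<omega>. 8 * (L2norm (cplx \<beta>))\<^sup>2 * ((L2norm (cplx (X \<omega>)))\<^sup>2 * (L2norm (cplx (W \<omega>)))\<^sup>2)
      + 2 * \<sigma>\<^sup>2 * ((U \<omega>)\<^sup>2 * (L2norm (cplx (W \<omega>)))\<^sup>2))"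
    by (intro Bochner_Integration.integrable_add integrable_mult_right integrable_sq_prod)
  then show ?thesis by (simp add: envelope_def algebra_simps)
qed

lemma error_term_sq_le:
  assumes w: "\<omega> \<in> space M"
  shows "(cmod (error_term (b k) k (Z \<omega>)))\<^sup>2 \<le> envelope \<omega> * (cmod (ip (cplx (W \<omega>)) (\<phi> k)))\<^sup>2"
proof -
  define r where "r = of_real (Y \<omega>) - b k * ip (\<phi> k) (cplx (X \<omega>))"
  define B where "B = L2norm (cplx \<beta>) * L2norm (cplx (X \<omega>))"
  have "cmod (b k) \<le> L2norm (cplx \<beta>)"
    using ip_Cauchy_Schwarz[OF slope_L2 L2_phi[of k]] by (simp add: L2norm_phi)
  then have 1: "cmod (b k * ip (\<phi> k) (cplx (X \<omega>))) \<le> B"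
    using X.norm_coef_le[OF w, of k] unfolding B_def
    by (simp add: norm_mult ip_cnj[of "cplx (X \<omega>)" "\<phi> k", symmetric] mult_mono L2norm_nonneg)
  have 2: "cmod (ip (cplx \<beta>) (cplx (X \<omega>))) \<le> B"
    unfolding B_def by (rule ip_Cauchy_Schwarz[OF slope_L2 X.in_L2[OF w]])
  have "cmod (of_real (Y \<omega>)) \<le> B + \<bar>\<sigma> * U \<omega>\<bar>"
    unfolding response_cplx[OF w]
    using 2 by (intro norm_triangle_le) (simp add: norm_mult abs_mult)
  then have "cmod r \<le> 2 * B + \<bar>\<sigma> * U \<omega>\<bar>"
    unfolding r_def using 1 norm_triangle_ineq4[of "of_real (Y \<omega>)" "b k * ip (\<phi> k) (cplx (X \<omega>))"]
    by linarith
  then have "(cmod r)\<^sup>2 \<le> (2 * B + \<bar>\<sigma> * U \<omega>\<bar>)\<^sup>2" by (intro power_mono) auto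
  also have "\<dots> \<le> 2 * (2 * B)\<^sup>2 + 2 * \<bar>\<sigma> * U \<omega>\<bar>\<^sup>2"
    using sum_squares_bound[of "2 * B" "\<bar>\<sigma> * U \<omega>\<bar>"] by (simp only: power2_sum)
  also have "\<dots> = envelope \<omega>"
    by (simp add: envelope_def B_def power_mult_distrib)
  finally have r: "(cmod r)\<^sup>2 \<le> envelope \<omega>" .
  have "error_term (b k) k (Z \<omega>) = r * ip (cplx (W \<omega>)) (\<phi> k)"
    by (simp add: error_term_def cross_term_def r_def left_diff_distrib)
  then show ?thesis using r by (simp add: norm_mult power_mult_distrib mult_right_mono)
qed

lemma error_term_sq: "integrable M (\<lambda>\<omega>. (cmod (error_term (b k) k (Z \<omega>)))\<^sup>2)"
proof (rule Bochner_Integration.integrable_bound[OF integrable_envelope])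
  have "(cmod (error_term (b k) k (Z \<omega>)))\<^sup>2 \<le> envelope \<omega> * (L2norm (cplx (W \<omega>)))\<^sup>2"
    if w: "\<omega> \<in> space M" for \<omega>
    using error_term_sq_le[OF w, of k] power_mono[OF W.norm_coef_le[OF w, of k], of 2] envelope_nonneg[of \<omega>]
    by (meson mult_left_mono norm_ge_zero order_trans)
  then show "AE \<omega> in M. norm ((cmod (error_term (b k) k (Z \<omega>)))\<^sup>2) \<le> norm (envelope \<omega> * (L2norm (cplx (W \<omega>)))\<^sup>2)"
    by (intro AE_I2) (auto simp: envelope_nonneg)
qed measurable

definition error_var :: "int \<Rightarrow> real" where
  "error_var k = expectation (\<lambda>\<omega>. (cmod (error_term (b k) k (Z \<omega>)))\<^sup>2)"

definition error_total :: real where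
  "error_total = expectation (\<lambda>\<omega>. envelope \<omega> * (L2norm (cplx (W \<omega>)))\<^sup>2)"

lemma error_var_nonneg: "0 \<le> error_var k"
  unfolding error_var_def by (rule integral_nonneg_AE) simp

lemma error_total_nonneg: "0 \<le> error_total"
  unfolding error_total_def by (rule integral_nonneg_AE) (simp add: envelope_nonneg)

text \<open>Exchange sum and expectation. As the envelope is free of k it leaves the sum, and
  Parseval collapses the squared coefficients of W into the squared norm.\<close>

lemma sum_error_var: "(\<integral>\<^sup>+k. ennreal (error_var k) \<partial>count_space UNIV) \<le> ennreal error_total"
proof -
  have "(\<integral>\<^sup>+k. ennreal (error_var k) \<partial>count_space UNIV)
    = (\<integral>\<^sup>+k. (\<integral>\<^sup>+\<omega>. ennreal ((cmod (error_term (b k) k (Z \<omega>)))\<^sup>2) \<partial>M) \<partial>count_space UNIV)"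
    unfolding error_var_def
    by (intro nn_integral_cong nn_integral_eq_integral[symmetric] error_term_sq) simp
  also have "\<dots> = (\<integral>\<^sup>+\<omega>. (\<integral>\<^sup>+k. ennreal ((cmod (error_term (b k) k (Z \<omega>)))\<^sup>2) \<partial>count_space UNIV) \<partial>M)"
    by (rule nn_integral_count_space_nn_integral[symmetric]) (auto, measurable)
  also have "\<dots> \<le> (\<integral>\<^sup>+\<omega>. ennreal (envelope \<omega> * (L2norm (cplx (W \<omega>)))\<^sup>2) \<partial>M)"
  proof (rule nn_integral_mono)
    fix \<omega> assume w: "\<omega> \<in> space M"
    have "(\<integral>\<^sup>+k. ennreal ((cmod (error_term (b k) k (Z \<omega>)))\<^sup>2) \<partial>count_space UNIV)
      \<le> (\<integral>\<^sup>+k. ennreal (envelope \<omega>) * ennreal ((cmod (ip (cplx (W \<omega>)) (\<phi> k)))\<^sup>2) \<partial>count_space UNIV)"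
      by (intro nn_integral_mono) (simp add: error_term_sq_le[OF w] ennreal_leI envelope_nonneg flip: ennreal_mult)
    also have "\<dots> = ennreal (envelope \<omega> * (L2norm (cplx (W \<omega>)))\<^sup>2)"
      by (simp add: nn_integral_cmult Parseval[OF W.in_L2real[OF w]] ennreal_mult envelope_nonneg)
    finally show "(\<integral>\<^sup>+k. ennreal ((cmod (error_term (b k) k (Z \<omega>)))\<^sup>2) \<partial>count_space UNIV)
      \<le> ennreal (envelope \<omega> * (L2norm (cplx (W \<omega>)))\<^sup>2)" .
  qed
  also have "\<dots> = ennreal error_total"
    unfolding error_total_def
    by (rule nn_integral_eq_integral[OF integrable_envelope]) (simp add: envelope_nonneg)
  finally show ?thesis .
qed

end

section \<open>The risk of the estimator\<close>

lemma ennreal_lincomb: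
  "0 \<le> p \<Longrightarrow> 0 \<le> q \<Longrightarrow> 0 \<le> s \<Longrightarrow> 0 \<le> t \<Longrightarrow>
    ennreal (p * s + q * t) = ennreal p * ennreal s + ennreal q * ennreal t"
  by (simp add: ennreal_mult)

locale regression_sample = instrumental_regression M X W U Y \<beta> \<sigma>
  for M :: "'a measure" and X W :: "'a \<Rightarrow> real \<Rightarrow> real" and U Y \<beta> \<sigma> +
  fixes P :: "'b measure" and n :: nat and y :: "nat \<Rightarrow> 'b \<Rightarrow> real" and x w :: "nat \<Rightarrow> 'b \<Rightarrow> real \<Rightarrow> real"
    and \<alpha> :: real
  assumes iid: "iid_sample P data_space n (\<lambda>i \<omega>. (y i \<omega>, x i \<omega>, w i \<omega>)) M Z"
    and n: "n \<ge> 1" and \<alpha>: "\<alpha> > 0"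
begin

abbreviation chat :: "int \<Rightarrow> 'b \<Rightarrow> complex" where
  "chat k \<omega> \<equiv> c_hat n (\<lambda>i. x i \<omega>) (\<lambda>i. w i \<omega>) k"

abbreviation what :: "int \<Rightarrow> 'b \<Rightarrow> real" where
  "what k \<omega> \<equiv> w_hat n (\<lambda>i. w i \<omega>) k"

abbreviation hhat :: "int \<Rightarrow> 'b \<Rightarrow> complex" where
  "hhat k \<omega> \<equiv> h_hat n (\<lambda>i. y i \<omega>) (\<lambda>i. w i \<omega>) k"

text \<open>An integrated indicator instead of the measure of a set, so that pointwise bounds can be
  integrated directly and Tonelli applies in \<open>risk_le\<close>.\<close>

definition lost_prob :: "real \<Rightarrow> int \<Rightarrow> ennreal" where
  "lost_prob \<nu> k = (\<integral>\<^sup>+\<omega>. ennreal (of_bool (\<not> kept \<nu> \<alpha> (chat k \<omega>) (what k \<omega>) k)) \<partial>P)"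

lemma prob_space_P: "prob_space P"
  using iid by (simp add: iid_sample_def)

lemma measurable_data: "i \<in> {1..n} \<Longrightarrow> (\<lambda>\<omega>. (y i \<omega>, x i \<omega>, w i \<omega>)) \<in> measurable P data_space"
  using iid unfolding iid_sample_def by (auto simp: prob_space.indep_vars_def2)

lemma w_in_L2real: "\<omega> \<in> space P \<Longrightarrow> i \<in> {1..n} \<Longrightarrow> w i \<omega> \<in> L2real"
  using measurable_space[OF measurable_data, of i \<omega>] by (simp add: space_pair_measure)

lemma measurable_mean:
  "F \<in> borel_measurable data_space \<Longrightarrow>
    (\<lambda>\<omega>. 1 / of_nat n * (\<Sum>i=1..n. F (y i \<omega>, x i \<omega>, w i \<omega>)) :: complex) \<in> borel_measurable P"
  by (intro borel_measurable_times borel_measurable_const borel_measurable_sum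
      measurable_compose[OF measurable_data])

lemma measurable_hats [measurable]:
  "chat k \<in> borel_measurable P" "what k \<in> borel_measurable P"
  "(\<lambda>\<omega>. hhat k \<omega> - c * chat k \<omega>) \<in> borel_measurable P"
proof -
  show "chat k \<in> borel_measurable P"
    \<comment> \<open>With centring constant 0 the error identity becomes a formula for the
      empirical coefficient itself.\<close>
    using measurable_mean[of "\<lambda>z. cross_term k z - 0"] c_hat_error[OF n, of _ _ k 0] by simp
  have "what k \<omega> = Re (1 / of_nat n * (\<Sum>i=1..n. power_term k (y i \<omega>, x i \<omega>, w i \<omega>) - of_real 0))" for \<omega>
    unfolding w_hat_error[OF n, symmetric] by simp
  then show "what k \<in> borel_measurable P"
    by (simp only:) (rule measurable_compose[OF measurable_mean borel_measurable_Re], measurable)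
  show "(\<lambda>\<omega>. hhat k \<omega> - c * chat k \<omega>) \<in> borel_measurable P"
    unfolding h_hat_error by (rule measurable_mean) measurable
qed

lemma c_hat_mean_square:
  "(\<integral>\<^sup>+\<omega>. ennreal ((cmod (chat k \<omega> - c_coef M X W k))\<^sup>2) \<partial>P)
    = ennreal (expectation (\<lambda>\<omega>. (cmod (cross_term k (Z \<omega>) - c_coef M X W k))\<^sup>2) / n)"
proof -
  have "integrable M (\<lambda>\<omega>. cross_term k (Z \<omega>))"
    using cross_moment_bound(1)[OF L2_phi, of k k] by (simp add: cross_term_def)
  then have "expectation (\<lambda>\<omega>. cross_term k (Z \<omega>) - c_coef M X W k) = 0"
    by (simp add: expectation_cross_term prob_space)
  moreover have "integrable M (\<lambda>\<omega>. (cmod (cross_term k (Z \<omega>) - c_coef M X W k))\<^sup>2)"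
    by (intro integrable_norm_diff_const_sq cross_term_sq) (unfold_locales, measurable)
  moreover have "chat k \<omega> - c_coef M X W k
      = 1 / of_nat n * (\<Sum>i=1..n. cross_term k (y i \<omega>, x i \<omega>, w i \<omega>) - c_coef M X W k)" for \<omega>
    by (rule c_hat_error[OF n])
  ultimately show ?thesis
    by (simp only:) (rule iid_mean_square[OF iid n measurable_Z, of "\<lambda>z. cross_term k z - c_coef M X W k"]; measurable)
qed

lemma w_hat_mean_square:
  "(\<integral>\<^sup>+\<omega>. ennreal (\<bar>what k \<omega> - coef_var M W k\<bar>\<^sup>2) \<partial>P)
    = ennreal (expectation (\<lambda>\<omega>. (cmod (power_term k (Z \<omega>) - of_real (coef_var M W k)))\<^sup>2) / n)"
proof -
  have "integrable M (\<lambda>\<omega>. power_term k (Z \<omega>))"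
    using W.integrable_ip_sq[OF L2_phi[of k]] unfolding power_term_def
    by (simp del: of_real_power)
  then have "expectation (\<lambda>\<omega>. power_term k (Z \<omega>) - of_real (coef_var M W k)) = 0"
    by (simp add: expectation_power_term prob_space)
  moreover have "integrable M (\<lambda>\<omega>. (cmod (power_term k (Z \<omega>) - of_real (coef_var M W k)))\<^sup>2)"
    by (intro integrable_norm_diff_const_sq power_term_sq) (unfold_locales, measurable)
  moreover have "\<bar>what k \<omega> - coef_var M W k\<bar>
      = cmod (1 / of_nat n * (\<Sum>i=1..n. power_term k (y i \<omega>, x i \<omega>, w i \<omega>) - of_real (coef_var M W k)))" for \<omega>
    unfolding w_hat_error[OF n, symmetric] by (rule norm_of_real[symmetric])
  ultimately show ?thesis
    by (simp only:) (rule iid_mean_square[OF iid n measurable_Z, of "\<lambda>z. power_term k z - of_real (coef_var M W k)"]; measurable)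
qed

lemma h_hat_mean_square:
  "(\<integral>\<^sup>+\<omega>. ennreal ((cmod (hhat k \<omega> - b k * chat k \<omega>))\<^sup>2) \<partial>P) = ennreal (error_var k / n)"
  unfolding h_hat_error error_var_def
  by (intro iid_mean_square[OF iid n measurable_Z] error_term_sq expectation_error_term) measurable

lemma lost_prob_le_1: "lost_prob \<nu> k \<le> 1"
proof -
  interpret P: prob_space P by (rule prob_space_P)
  have "lost_prob \<nu> k \<le> (\<integral>\<^sup>+\<omega>. 1 \<partial>P)"
    unfolding lost_prob_def by (intro nn_integral_mono) simp
  then show ?thesis by (simp add: P.emeasure_space_1)
qed

text \<open>The integrated form of \<open>not_kept_le\<close>, with both mean squares evaluated by
  \<open>iid_mean_square\<close>. For fixed k the bound is a constant over n; that constant depends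
  on k through the reciprocals of the variance and of the cross moment.\<close>

lemma lost_prob_le:
  assumes "\<alpha> \<le> coef_var M W k / 2"
    and "\<alpha> * \<gamma> k powr \<nu> \<le> (cmod (c_coef M X W k))\<^sup>2 / (8 * coef_var M W k)"
  shows "lost_prob \<nu> k \<le> ennreal
    ((4 / (coef_var M W k)\<^sup>2 * expectation (\<lambda>\<omega>. (cmod (power_term k (Z \<omega>) - of_real (coef_var M W k)))\<^sup>2)
      + 4 / (cmod (c_coef M X W k))\<^sup>2 * expectation (\<lambda>\<omega>. (cmod (cross_term k (Z \<omega>) - c_coef M X W k))\<^sup>2)) / n)"
proof -
  let ?v = "coef_var M W k" and ?c = "c_coef M X W k"
  have "lost_prob \<nu> k \<le> (\<integral>\<^sup>+\<omega>. ennreal (4 / ?v\<^sup>2) * ennreal (\<bar>what k \<omega> - ?v\<bar>\<^sup>2)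
      + ennreal (4 / (cmod ?c)\<^sup>2) * ennreal ((cmod (chat k \<omega> - ?c))\<^sup>2) \<partial>P)"
    unfolding lost_prob_def
  proof (rule nn_integral_mono)
    fix \<omega>
    have "ennreal (of_bool (\<not> kept \<nu> \<alpha> (chat k \<omega>) (what k \<omega>) k))
      \<le> ennreal (4 / ?v\<^sup>2 * \<bar>what k \<omega> - ?v\<bar>\<^sup>2 + 4 / (cmod ?c)\<^sup>2 * (cmod (chat k \<omega> - ?c))\<^sup>2)"
      by (intro ennreal_leI not_kept_le c_coef_nonzero coef_var_W_pos \<alpha> assms)
    then show "ennreal (of_bool (\<not> kept \<nu> \<alpha> (chat k \<omega>) (what k \<omega>) k))
      \<le> ennreal (4 / ?v\<^sup>2) * ennreal (\<bar>what k \<omega> - ?v\<bar>\<^sup>2)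
      + ennreal (4 / (cmod ?c)\<^sup>2) * ennreal ((cmod (chat k \<omega> - ?c))\<^sup>2)"
      by (subst (asm) ennreal_lincomb) auto
  qed
  also have "\<dots> = ennreal (4 / ?v\<^sup>2) * (\<integral>\<^sup>+\<omega>. ennreal (\<bar>what k \<omega> - ?v\<bar>\<^sup>2) \<partial>P)
      + ennreal (4 / (cmod ?c)\<^sup>2) * (\<integral>\<^sup>+\<omega>. ennreal ((cmod (chat k \<omega> - ?c))\<^sup>2) \<partial>P)"
    by (subst nn_integral_add, measurable) (simp add: nn_integral_cmult del: power2_abs)
  also have "\<dots> = ennreal
    ((4 / ?v\<^sup>2 * expectation (\<lambda>\<omega>. (cmod (power_term k (Z \<omega>) - of_real ?v))\<^sup>2)
      + 4 / (cmod ?c)\<^sup>2 * expectation (\<lambda>\<omega>. (cmod (cross_term k (Z \<omega>) - ?c))\<^sup>2)) / n)"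
    unfolding c_hat_mean_square w_hat_mean_square
    by (subst (1 2) ennreal_mult[symmetric])
       (auto intro!: integral_nonneg_AE divide_nonneg_nonneg mult_nonneg_nonneg simp: add_divide_distrib simp flip: ennreal_plus)
  finally show ?thesis .
qed

text \<open>\<open>coef_error_bound\<close> integrated and summed, with sum and expectation
  exchanged. The variance part closes by \<open>sum_error_var\<close>; the bias stays a series,
  since the probabilities in it are controlled only for one k at a time.\<close>

lemma risk_le:
  "(\<integral>\<^sup>+\<omega>. wnorm2 \<nu> (\<lambda>t. beta_hat \<nu> \<alpha> n (\<lambda>i. y i \<omega>) (\<lambda>i. x i \<omega>) (\<lambda>i. w i \<omega>) t - cplx \<beta> t) \<partial>P)
    \<le> ennreal (error_total * inverse (\<alpha>\<^sup>2 * n))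
      + (\<integral>\<^sup>+k. ennreal (\<gamma> k powr \<nu> * (cmod (b k))\<^sup>2) * lost_prob \<nu> k \<partial>count_space UNIV)"
proof -
  define e where "e k \<omega> = ennreal (1 / \<alpha>\<^sup>2) * ennreal ((cmod (hhat k \<omega> - b k * chat k \<omega>))\<^sup>2)" for k \<omega>
  define l where "l k \<omega> = ennreal (\<gamma> k powr \<nu> * (cmod (b k))\<^sup>2)
    * ennreal (of_bool (\<not> kept \<nu> \<alpha> (chat k \<omega>) (what k \<omega>) k))" for k \<omega>
  have [measurable]: "e k \<in> borel_measurable P" for k
    unfolding e_def[abs_def] by measurable
  have [measurable]: "(\<lambda>\<omega>. ennreal (of_bool (\<not> kept \<nu> \<alpha> (chat k \<omega>) (what k \<omega>) k))) \<in> borel_measurable P" for k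
    unfolding kept_def of_bool_def by measurable
  have [measurable]: "l k \<in> borel_measurable P" for k
    unfolding l_def[abs_def] by measurable
  have "(\<integral>\<^sup>+\<omega>. wnorm2 \<nu> (\<lambda>t. beta_hat \<nu> \<alpha> n (\<lambda>i. y i \<omega>) (\<lambda>i. x i \<omega>) (\<lambda>i. w i \<omega>) t - cplx \<beta> t) \<partial>P)
    \<le> (\<integral>\<^sup>+\<omega>. (\<integral>\<^sup>+k. e k \<omega> + l k \<omega> \<partial>count_space UNIV) \<partial>P)"
    unfolding wnorm2_def
  proof (intro nn_integral_mono)
    fix \<omega> k assume "\<omega> \<in> space P"
    then have "\<gamma> k powr \<nu> * (cmod (ip (\<lambda>t. beta_hat \<nu> \<alpha> n (\<lambda>i. y i \<omega>) (\<lambda>i. x i \<omega>) (\<lambda>i. w i \<omega>) t - cplx \<beta> t) (\<phi> k)))\<^sup>2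
      \<le> (cmod (hhat k \<omega> - b k * chat k \<omega>))\<^sup>2 / \<alpha>\<^sup>2
        + \<gamma> k powr \<nu> * (cmod (b k))\<^sup>2 * of_bool (\<not> kept \<nu> \<alpha> (chat k \<omega>) (what k \<omega>) k)"
      by (intro coef_error_bound \<alpha> w_in_L2real slope_L2)
    from ennreal_leI[OF this]
    show "ennreal (\<gamma> k powr \<nu> * (cmod (ip (\<lambda>t. beta_hat \<nu> \<alpha> n (\<lambda>i. y i \<omega>) (\<lambda>i. x i \<omega>) (\<lambda>i. w i \<omega>) t - cplx \<beta> t) (\<phi> k)))\<^sup>2)
      \<le> e k \<omega> + l k \<omega>"
      unfolding e_def l_def
      by (subst (asm) ennreal_plus) (auto simp flip: ennreal_mult)
  qed
  also have "\<dots> = (\<integral>\<^sup>+k. (\<integral>\<^sup>+\<omega>. e k \<omega> + l k \<omega> \<partial>P) \<partial>count_space UNIV)"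
    by (rule nn_integral_count_space_nn_integral) auto
  also have "\<dots> = (\<integral>\<^sup>+k. ennreal (1 / (\<alpha>\<^sup>2 * n)) * ennreal (error_var k)
      + ennreal (\<gamma> k powr \<nu> * (cmod (b k))\<^sup>2) * lost_prob \<nu> k \<partial>count_space UNIV)"
  proof (rule nn_integral_cong)
    fix k
    have "(\<integral>\<^sup>+\<omega>. e k \<omega> \<partial>P) = ennreal (1 / \<alpha>\<^sup>2) * ennreal (error_var k / n)"
      unfolding e_def by (subst nn_integral_cmult) (simp_all add: h_hat_mean_square)
    also have "\<dots> = ennreal (1 / (\<alpha>\<^sup>2 * n)) * ennreal (error_var k)"
      using error_var_nonneg[of k] by (simp flip: ennreal_mult)
    finally have E: "(\<integral>\<^sup>+\<omega>. e k \<omega> \<partial>P) = ennreal (1 / (\<alpha>\<^sup>2 * n)) * ennreal (error_var k)" .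
    have L: "(\<integral>\<^sup>+\<omega>. l k \<omega> \<partial>P) = ennreal (\<gamma> k powr \<nu> * (cmod (b k))\<^sup>2) * lost_prob \<nu> k"
      unfolding l_def lost_prob_def by (rule nn_integral_cmult) measurable
    show "(\<integral>\<^sup>+\<omega>. e k \<omega> + l k \<omega> \<partial>P) = ennreal (1 / (\<alpha>\<^sup>2 * n)) * ennreal (error_var k)
      + ennreal (\<gamma> k powr \<nu> * (cmod (b k))\<^sup>2) * lost_prob \<nu> k"
      by (subst nn_integral_add) (simp_all add: E L)
  qed
  also have "\<dots> = ennreal (1 / (\<alpha>\<^sup>2 * n)) * (\<integral>\<^sup>+k. ennreal (error_var k) \<partial>count_space UNIV)
      + (\<integral>\<^sup>+k. ennreal (\<gamma> k powr \<nu> * (cmod (b k))\<^sup>2) * lost_prob \<nu> k \<partial>count_space UNIV)"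
    by (subst nn_integral_add) (simp_all add: nn_integral_cmult)
  also have "ennreal (1 / (\<alpha>\<^sup>2 * n)) * (\<integral>\<^sup>+k. ennreal (error_var k) \<partial>count_space UNIV)
      \<le> ennreal (1 / (\<alpha>\<^sup>2 * n)) * ennreal error_total"
    by (intro mult_left_mono sum_error_var) simp
  also have "\<dots> = ennreal (error_total * inverse (\<alpha>\<^sup>2 * n))"
    using error_total_nonneg by (simp add: divide_inverse mult.commute flip: ennreal_mult)
  finally show ?thesis by (simp add: add_right_mono)
qed

end

theorem proposition3p1:
  fixes M :: "'a measure" and X W :: "'a \<Rightarrow> real \<Rightarrow> real" and U Y :: "'a \<Rightarrow> real"
    and N :: "nat \<Rightarrow> 'b measure"
    and Ys :: "nat \<Rightarrow> nat \<Rightarrow> 'b \<Rightarrow> real" and Xs Ws :: "nat \<Rightarrow> nat \<Rightarrow> 'b \<Rightarrow> real \<Rightarrow> real"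
    and \<beta> :: "real \<Rightarrow> real" and \<sigma> p \<nu> \<eta> \<tau> :: real and \<alpha> :: "nat \<Rightarrow> real"
  assumes "prob_space M"
    and "\<sigma> > 0" and "p \<ge> 0" and "0 \<le> \<nu>" and "\<nu> \<le> p" and "\<eta> \<ge> 1" and "\<tau> \<ge> 1"
    and "cplx \<beta> \<in> sobolev p"
    and "(X, W) \<in> class_F_mom M 8 \<eta> \<tau>"
    and "U \<in> class_E M 4 \<eta>"
    and "\<And>t. t \<in> {0..1} \<Longrightarrow> prob_space.expectation M (\<lambda>\<omega>. U \<omega> * W \<omega> t) = 0"
    and "\<And>\<omega>. \<omega> \<in> space M \<Longrightarrow> Y \<omega> = (LINT t|I01. \<beta> t * X \<omega> t) + \<sigma> * U \<omega>"
    and "\<And>n. iid_sample (N n) (borel \<Otimes>\<^sub>M L2borel \<Otimes>\<^sub>M L2borel) n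
           (\<lambda>i \<omega>. (Ys n i \<omega>, Xs n i \<omega>, Ws n i \<omega>)) M (\<lambda>\<omega>. (Y \<omega>, X \<omega>, W \<omega>))"
    and "\<And>n. \<alpha> n > 0"
    and "\<alpha> \<longlonglongrightarrow> 0"
    and "(\<lambda>n. inverse ((\<alpha> n)\<^sup>2 * real n)) \<longlonglongrightarrow> 0"
  shows "(\<lambda>n. \<integral>\<^sup>+ \<omega>. wnorm2 \<nu>
             (\<lambda>t. beta_hat \<nu> (\<alpha> n) n (\<lambda>i. Ys n i \<omega>) (\<lambda>i. Xs n i \<omega>) (\<lambda>i. Ws n i \<omega>) t - cplx \<beta> t)
           \<partial>N n) \<longlonglongrightarrow> 0"
proof -
  interpret stationary_model M X W
  proof (rule stationary_model.intro)
    show "prob_space M" by fact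
    show "stationary_model_axioms M X W"
      using assms(9) by unfold_locales (simp add: class_F_mom_def)
  qed
  have \<beta>: "\<beta> \<in> L2real" and fin: "wnorm2 p (cplx \<beta>) < \<infinity>"
    using assms(8) by (auto simp: sobolev_def L2real_def)
  have \<eta>: "0 \<le> \<eta>" using assms(6) by simp
  have U: "integrable M U" and U4: "(\<integral>\<^sup>+\<omega>. ennreal (\<bar>U \<omega>\<bar> ^ 4) \<partial>M) \<le> ennreal \<eta>"
    using assms(10) by (auto simp: class_E_def)
  interpret instrumental_regression M X W U Y \<beta> \<sigma>
  proof unfold_locales
    show "integrable M (\<lambda>\<omega>. (L2norm (cplx (X \<omega>))) ^ 4)"
      using assms(9) by (intro X.L2norm_fourth_moment[OF _ \<eta>]) (simp add: class_F_mom_def)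
    show "integrable M (\<lambda>\<omega>. (L2norm (cplx (W \<omega>))) ^ 4)"
      using assms(9) by (intro W.L2norm_fourth_moment[OF _ \<eta>]) (simp add: class_F_mom_def)
    show Um: "U \<in> borel_measurable M" using U by simp
    show "integrable M (\<lambda>\<omega>. (U \<omega>) ^ 4)"
    proof (rule integrableI_bounded)
      have "(\<integral>\<^sup>+\<omega>. ennreal (norm ((U \<omega>) ^ 4)) \<partial>M) \<le> ennreal \<eta>"
        using U4 by (simp add: power_abs)
      then show "(\<integral>\<^sup>+\<omega>. ennreal (norm ((U \<omega>) ^ 4)) \<partial>M) < \<infinity>"
        by (rule le_less_trans) simp
    qed (use Um in measurable)
  qed (use \<beta> assms(11,12) in auto)
  have sample: "regression_sample M X W U Y \<beta> \<sigma> (N n) n (Ys n) (Xs n) (Ws n) (\<alpha> n)" if "n \<ge> 1" for n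
    using that assms(13,14) by unfold_locales auto
  \<comment> \<open>The sample lemmas require n \<ge> 1; the value 0 at n = 0 keeps
    \<open>q n k\<close> \<le> 1 for every n, as the domination below requires.\<close>
  define q where "q n k = (if n \<ge> 1 then regression_sample.lost_prob (N n) n (Xs n) (Ws n) (\<alpha> n) \<nu> k else 0)"
    for n k
  define u where "u k = ennreal (\<gamma> k powr \<nu> * (cmod (b k))\<^sup>2)" for k
  have q1: "q n k \<le> 1" for n k
    unfolding q_def using regression_sample.lost_prob_le_1[OF sample] by auto
  have q0: "(\<lambda>n. q n k) \<longlonglongrightarrow> 0" for k
  proof -
    define v where "v = coef_var M W k"
    define c where "c = cmod (c_coef M X W k)"
    define g where "g = \<gamma> k powr \<nu>"
    \<comment> \<open>Here k is fixed, so \<open>C\<close> is a number independent of n and the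
      bound from \<open>lost_prob_le\<close> is \<open>C / n\<close>.\<close>
    define C where "C = 4 / (coef_var M W k)\<^sup>2 * expectation (\<lambda>\<omega>. (cmod (power_term k (Z \<omega>) - of_real (coef_var M W k)))\<^sup>2)
      + 4 / (cmod (c_coef M X W k))\<^sup>2 * expectation (\<lambda>\<omega>. (cmod (cross_term k (Z \<omega>) - c_coef M X W k))\<^sup>2)"
    have pos: "v > 0" "c > 0" "g > 0"
      using gamma_powr_pos[of k \<nu>] by (simp_all add: v_def c_def g_def coef_var_W_pos c_coef_nonzero)
    have "\<forall>\<^sub>F n in sequentially. \<alpha> n < v / 2"
      using pos by (intro order_tendstoD[OF assms(15)]) auto
    \<comment> \<open>The second hypothesis of \<open>lost_prob_le\<close> solved for the threshold;
      for fixed k the right side is a positive constant, so a vanishing threshold eventually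
      satisfies it.\<close>
    moreover have "\<forall>\<^sub>F n in sequentially. \<alpha> n < c\<^sup>2 / (8 * v) / g"
      using pos by (intro order_tendstoD[OF assms(15)]) auto
    moreover have "\<forall>\<^sub>F n in sequentially. 1 \<le> n"
      by (rule eventually_ge_at_top)
    ultimately have "\<forall>\<^sub>F n in sequentially. q n k \<le> ennreal (C / n)"
    proof eventually_elim
      case (elim n)
      have "\<alpha> n * g \<le> c\<^sup>2 / (8 * v)"
        using elim(2) unfolding pos_less_divide_eq[OF pos(3)] by simp
      then show ?case
        using regression_sample.lost_prob_le[OF sample[OF elim(3)], of k \<nu>] elim
        by (simp add: q_def C_def v_def c_def g_def)
    qed
    moreover have "(\<lambda>n. ennreal (C / real n)) \<longlonglongrightarrow> ennreal 0"
      by (intro tendsto_ennrealI lim_const_over_n)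
    then have "(\<lambda>n. ennreal (C / real n)) \<longlonglongrightarrow> 0" by simp
    ultimately show ?thesis
      by (rule tendsto_sandwich[OF always_eventually[OF allI[OF zero_le]] _ tendsto_const])
  qed
  \<comment> \<open>All weights are at least 1, so raising the exponent from \<nu> to p only
    enlarges the terms, and the smoothness of the slope bounds the sum.\<close>
  have u_fin: "(\<integral>\<^sup>+k. u k \<partial>count_space UNIV) < \<infinity>"
  proof (rule le_less_trans[OF _ fin])
    show "(\<integral>\<^sup>+k. u k \<partial>count_space UNIV) \<le> wnorm2 p (cplx \<beta>)"
      unfolding u_def wnorm2_def
      by (intro nn_integral_mono ennreal_leI mult_right_mono gamma_powr_mono assms) simp
  qed
  have "(\<lambda>n. \<integral>\<^sup>+k. u k * q n k \<partial>count_space UNIV) \<longlonglongrightarrow> (\<integral>\<^sup>+(k::int). 0 \<partial>count_space UNIV)"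
  proof (rule nn_integral_dominated_convergence[where w=u])
    show "AE k in count_space UNIV. u k * q n k \<le> u k" for n
      using mult_left_mono[OF q1[of n], of "u _"] by (intro AE_I2) simp
    show "AE k in count_space UNIV. (\<lambda>n. u k * q n k) \<longlonglongrightarrow> 0"
    proof (rule AE_I2)
      fix k
      have "(\<lambda>n. u k * q n k) \<longlonglongrightarrow> u k * 0"
        by (intro ennreal_tendsto_cmult q0) (simp add: u_def)
      then show "(\<lambda>n. u k * q n k) \<longlonglongrightarrow> 0" by simp
    qed
  qed (use u_fin in auto)
  moreover have "(\<lambda>n. ennreal (error_total * inverse ((\<alpha> n)\<^sup>2 * real n))) \<longlonglongrightarrow> ennreal (error_total * 0)"
    by (intro tendsto_ennrealI tendsto_mult tendsto_const assms(16))
  ultimately have lim: "(\<lambda>n. ennreal (error_total * inverse ((\<alpha> n)\<^sup>2 * real n))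
      + (\<integral>\<^sup>+k. u k * q n k \<partial>count_space UNIV)) \<longlonglongrightarrow> 0"
    using tendsto_add by fastforce
  have "\<forall>\<^sub>F n in sequentially. (\<integral>\<^sup>+ \<omega>. wnorm2 \<nu>
       (\<lambda>t. beta_hat \<nu> (\<alpha> n) n (\<lambda>i. Ys n i \<omega>) (\<lambda>i. Xs n i \<omega>) (\<lambda>i. Ws n i \<omega>) t - cplx \<beta> t) \<partial>N n)
     \<le> ennreal (error_total * inverse ((\<alpha> n)\<^sup>2 * real n)) + (\<integral>\<^sup>+k. u k * q n k \<partial>count_space UNIV)"
    using eventually_ge_at_top[of 1]
  proof eventually_elim
    case (elim n)
    then show ?case
      using regression_sample.risk_le[OF sample[OF elim], of \<nu>] by (simp add: q_def u_def)
  qed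
  then show ?thesis
    by (rule tendsto_sandwich[OF always_eventually[OF allI[OF zero_le]] _ tendsto_const lim])
qed

end
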